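(* (1) The conjugacy class of a semisimple element $X\in\mathrm{SU}(n,q)$ in $\mathrm{SU}(n,q)$ coincides with the conjugacy class of $X$ in $\mathrm{U}(n,q)$; equivalently, two semisimple elements of $\mathrm{SU}(n,q)$ are conjugate in $\mathrm{SU}(n,q)$ if, and only if, they are conjugate in $\mathrm{U}(n,q)$. (2) Let $q$ be odd and $\epsilon\in\{+,-,\circ\}$. The conjugacy class of a semisimple $X\in\mathrm{SO}^{\epsilon}(n,q)$ in $\mathrm{SO}^{\epsilon}(n,q)$ coincides with the class of $X$ in $\mathrm{O}^{\epsilon}(n,q)$ if $X^2-1$ is singular; otherwise the class of $X$ in $\mathrm{O}^{\epsilon}(n,q)$ splits into two distinct classes in $\mathrm{SO}^{\epsilon}(n,q)$ with representatives $X$ and $X^Z$, for $Z\in\mathrm{O}^{\epsilon}(n,q)$ with $\det Z=-1$.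
   Context: $q$ is a prime power. $\mathrm{U}(n,q)$ is the isometry group of a non-degenerate hermitian form on $\mathbb{F}_{q^2}^n$; $\mathrm{O}^{\epsilon}(n,q)$ is the isometry group of a non-singular quadratic form on $\mathbb{F}_q^n$ (for $n$ even, of plus type if $\epsilon=+$ and of minus type if $\epsilon=-$; $\epsilon=\circ$ if $n$ is odd). $\mathrm{SU}(n,q)$ and $\mathrm{SO}^{\epsilon}(n,q)$ are their subgroups of elements of determinant $1$. An element is semisimple if its order is coprime to the characteristic. $X^Z=Z^{-1}XZ$. *)

theory Defs
  imports
    "HOL-Analysis.Determinants"
    "HOL-Algebra.Multiplicative_Group"
    "HOL-Number_Theory.Prime_Powers"
begin

definition general_linear_group :: "('a::field ^ 'n ^ 'n) monoid" where
  "general_linear_group = \<lparr>carrier = {A. invertible A}, mult = (**), one = mat 1\<rparr>"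

definition special_subgroup :: "('a::field ^ 'n ^ 'n) monoid \<Rightarrow> ('a ^ 'n ^ 'n) monoid" where
  "special_subgroup G = G\<lparr>carrier := {A \<in> carrier G. det A = 1}\<rparr>"

text \<open>Over a field with \<open>q\<^sup>2\<close> elements the involution is \<open>c \<mapsto> c\<^sup>q\<close>. Forms are linear in the
  first argument; by hermitian symmetry they are then semilinear in the second one.\<close>

definition hermitian_form :: "nat \<Rightarrow> ('a::field ^ 'n \<Rightarrow> 'a ^ 'n \<Rightarrow> 'a) \<Rightarrow> bool" where
  "hermitian_form q \<beta> \<longleftrightarrow>
     (\<forall>v. Vector_Spaces.linear (*s) (*) (\<lambda>u. \<beta> u v)) \<and> (\<forall>u v. \<beta> v u = \<beta> u v ^ q)"

definition nondegenerate_form :: "('a::field ^ 'n \<Rightarrow> 'a ^ 'n \<Rightarrow> 'a) \<Rightarrow> bool" where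
  "nondegenerate_form \<beta> \<longleftrightarrow> (\<forall>u. (\<forall>v. \<beta> u v = 0) \<longrightarrow> u = 0)"

definition unitary_group :: "('a::field ^ 'n \<Rightarrow> 'a ^ 'n \<Rightarrow> 'a) \<Rightarrow> ('a ^ 'n ^ 'n) monoid" where
  "unitary_group \<beta> = general_linear_group
     \<lparr>carrier := {A. invertible A \<and> (\<forall>u v. \<beta> (A *v u) (A *v v) = \<beta> u v)}\<rparr>"

definition polar_form :: "('a::field ^ 'n \<Rightarrow> 'a) \<Rightarrow> 'a ^ 'n \<Rightarrow> 'a ^ 'n \<Rightarrow> 'a" where
  "polar_form Q u v = Q (u + v) - Q u - Q v"

definition quadratic_form :: "('a::field ^ 'n \<Rightarrow> 'a) \<Rightarrow> bool" where
  "quadratic_form Q \<longleftrightarrow>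
     (\<forall>c v. Q (c *s v) = c\<^sup>2 * Q v) \<and>
     (\<forall>v. Vector_Spaces.linear (*s) (*) (\<lambda>u. polar_form Q u v)) \<and>
     (\<forall>u. Vector_Spaces.linear (*s) (*) (\<lambda>v. polar_form Q u v))"

text \<open>In odd characteristic, non-singularity amounts to non-degeneracy of the polar form.\<close>

definition nonsingular_quadratic_form :: "('a::field ^ 'n \<Rightarrow> 'a) \<Rightarrow> bool" where
  "nonsingular_quadratic_form Q \<longleftrightarrow>
     quadratic_form Q \<and> (\<forall>u. (\<forall>v. polar_form Q u v = 0) \<and> Q u = 0 \<longrightarrow> u = 0)"

definition witt_index :: "('a::{field,finite} ^ 'n \<Rightarrow> 'a) \<Rightarrow> nat" where
  "witt_index Q = Max (vec.dim ` {W. vec.subspace W \<and> (\<forall>w\<in>W. Q w = 0)})"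

datatype form_sign = Plus | Minus | Circ

fun has_sign :: "('a::{field,finite} ^ 'n \<Rightarrow> 'a) \<Rightarrow> form_sign \<Rightarrow> bool" where
  "has_sign Q Plus \<longleftrightarrow> even CARD('n) \<and> 2 * witt_index Q = CARD('n)"
| "has_sign Q Minus \<longleftrightarrow> even CARD('n) \<and> 2 * witt_index Q + 2 = CARD('n)"
| "has_sign Q Circ \<longleftrightarrow> odd CARD('n)"

definition orthogonal_group :: "('a::field ^ 'n \<Rightarrow> 'a) \<Rightarrow> ('a ^ 'n ^ 'n) monoid" where
  "orthogonal_group Q = general_linear_group
     \<lparr>carrier := {A. invertible A \<and> (\<forall>v. Q (A *v v) = Q v)}\<rparr>"

definition semisimple :: "('a::field ^ 'n ^ 'n) monoid \<Rightarrow> 'a ^ 'n ^ 'n \<Rightarrow> bool" where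
  "semisimple G X \<longleftrightarrow> coprime (group.ord G X) CHAR('a)"

definition conjugate_by :: "('g, 'b) monoid_scheme \<Rightarrow> 'g \<Rightarrow> 'g \<Rightarrow> 'g" where
  "conjugate_by G X Z = inv\<^bsub>G\<^esub> Z \<otimes>\<^bsub>G\<^esub> X \<otimes>\<^bsub>G\<^esub> Z"

definition conjugate_in :: "('g, 'b) monoid_scheme \<Rightarrow> 'g \<Rightarrow> 'g \<Rightarrow> bool" where
  "conjugate_in G X Y \<longleftrightarrow> (\<exists>Z\<in>carrier G. Y = conjugate_by G X Z)"

definition conjugacy_class :: "('g, 'b) monoid_scheme \<Rightarrow> 'g \<Rightarrow> 'g set" where
  "conjugacy_class G X = {Y. conjugate_in G X Y}"

end

theory Submission
  imports Defs "HOL-Computational_Algebra.Polynomial" "HOL-Number_Theory.Residues"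
begin

text \<open>The classes of \<open>X\<close> in the full isometry group and in the special group coincide iff every determinant
  of an isometry is the determinant of one that commutes with \<open>X\<close>.

  Unitary case: let \<open>P\<close> be an idempotent commuting with \<open>X\<close>, normal with respect to the adjoint \<open>*\<close>,
  whose image is an irreducible \<open>X\<close>-module: by Maschke's theorem there is an irreducible module that is
  nondegenerate or one of two totally isotropic modules dual to each other. For \<open>a\<close> in the bicommutant of \<open>X\<close>
  put \<open>r = 1 - P + a P\<close>. Then \<open>r\<close> is normal, so that \<open>r (r\<^sup>*)\<^sup>-\<^sup>1\<close> is an isometry commuting with \<open>X\<close>, of
  determinant \<open>\<mu> / \<mu>\<^sup>q\<close> with \<open>\<mu> = det r\<close>. A power sum argument in the style of Chevalley and Warning
  shows that \<open>\<mu>\<close> takes all nonzero values, and Hilbert 90 concludes.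

  Orthogonal case: if \<open>X\<close> has an eigenvalue \<open>e = 1\<close> or \<open>e = -1\<close>, the eigenspace is nondegenerate and a reflection in
  one of its vectors commutes with \<open>X\<close>. Otherwise the centralizer of \<open>X\<close> preserves the nondegenerate
  alternating form \<open>(u, v) \<mapsto> \<beta> ((X - X\<^sup>-\<^sup>1) u) v\<close>, so it consists of elements of determinant \<open>1\<close>.\<close>

section \<open>Power sums over finite fields\<close>

lemma of_nat_card_field: "of_nat CARD('a::{field,finite}) = (0::'a)"
  using of_nat_eq_0_iff_char_dvd CHAR_dvd_CARD by blast

text \<open>The polynomial \<open>x ^ e - 1\<close> has at most \<open>e\<close> roots, fewer than
  there are nonzero field elements.\<close>

lemma exists_power_noneq:
  assumes "0 < e" "e < CARD('a::{field,finite}) - 1"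
  shows "\<exists>x::'a. x \<noteq> 0 \<and> x ^ e \<noteq> 1"
proof (rule ccontr)
  assume "\<not> ?thesis"
  hence all: "x ^ e = 1" if "x \<noteq> 0" for x :: 'a
    using that by blast
  define p :: "'a poly" where "p = monom 1 e - 1"
  have deg: "degree p \<le> e"
    unfolding p_def by (intro degree_diff_le) (simp_all add: degree_monom_eq)
  have "coeff p e = 1"
    using assms by (simp add: p_def)
  hence "p \<noteq> 0" by auto
  hence "card {x. poly p x = 0} \<le> e"
    using card_poly_roots_bound[of p] deg by linarith
  moreover have "UNIV - {0} \<subseteq> {x. poly p x = 0}"
    using all by (auto simp: p_def poly_monom)
  hence "card (UNIV - {0::'a}) \<le> card {x. poly p x = 0}"
    by (intro card_mono) auto
  ultimately show False
    using assms by (simp add: card_Diff_subset)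
qed

text \<open>Substituting \<open>x * t\<close> for \<open>t\<close> permutes the terms but multiplies
  the sum by \<open>x ^ e\<close>, and \<open>x\<close> can be chosen so that this factor differs
  from \<open>1\<close>.\<close>

lemma sum_power_field_eq_0:
  assumes "e < CARD('a::{field,finite}) - 1"
  shows "(\<Sum>t\<in>UNIV. t ^ e) = (0::'a)"
proof (cases "e = 0")
  case True
  \<comment> \<open>Since \<open>0 ^ 0 = 1\<close>, all terms are \<open>1\<close> and the sum is
    \<open>CARD('a)\<close>, which is zero in the field.\<close>
  then show ?thesis by (simp add: of_nat_card_field)
next
  case False
  then obtain x :: 'a where x: "x \<noteq> 0" "x ^ e \<noteq> 1"
    using exists_power_noneq assms by blast
  have "bij (\<lambda>t. x * t)"
    by (rule bij_betw_byWitness[of _ "\<lambda>t. t / x"]) (use x in auto)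
  hence "(\<Sum>t\<in>UNIV. t ^ e) = (\<Sum>t\<in>UNIV. (x * t) ^ e)"
    by (rule sum.reindex_bij_betw[symmetric])
  also have "\<dots> = x ^ e * (\<Sum>t\<in>UNIV. t ^ e)"
    by (simp add: power_mult_distrib sum_distrib_left)
  finally show ?thesis
    using x by simp
qed

text \<open>The polynomial functions of total degree at most \<open>m\<close> in the variables
  indexed by \<open>I\<close>. The bound is attached to functions because only their values enter
  the sums over all points.\<close>

inductive deg_le :: "'i set \<Rightarrow> nat \<Rightarrow> (('i \<Rightarrow> 'a::field) \<Rightarrow> 'a) \<Rightarrow> bool" for I where
  const: "deg_le I m (\<lambda>c. a)"
| add: "deg_le I m f \<Longrightarrow> deg_le I m g \<Longrightarrow> deg_le I m (\<lambda>c. f c + g c)"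
| var: "i \<in> I \<Longrightarrow> deg_le I m f \<Longrightarrow> deg_le I (Suc m) (\<lambda>c. c i * f c)"

lemma deg_le_mono: "deg_le I m f \<Longrightarrow> m \<le> k \<Longrightarrow> deg_le I k f"
proof (induction arbitrary: k rule: deg_le.induct)
  case (var i m f)
  then obtain k' where "k = Suc k'" "m \<le> k'"
    by (metis Suc_le_D Suc_le_mono)
  with var.IH[of k'] show ?case
    using var.hyps(1) by (simp add: deg_le.var)
next
  case (const m a)
  show ?case by (rule deg_le.const)
next
  case (add m f g)
  then show ?case by (intro deg_le.add) blast+
qed

lemma deg_le_scale: "deg_le I m f \<Longrightarrow> deg_le I m (\<lambda>c. a * f c)"
proof (induction rule: deg_le.induct)
  case (const m b)
  then show ?case by (rule deg_le.const)
next
  case (add m f g)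
  then show ?case by (simp add: distrib_left deg_le.add)
next
  case (var i m f)
  then show ?case using deg_le.var[of i I m "\<lambda>c. a * f c"] by (simp add: mult.left_commute)
qed

lemma deg_le_mult: "deg_le I m f \<Longrightarrow> deg_le I k g \<Longrightarrow> deg_le I (m + k) (\<lambda>c. f c * g c)"
proof (induction rule: deg_le.induct)
  case (const m b)
  then show ?case using deg_le_mono[OF deg_le_scale, of I k g "m + k" b] by simp
next
  case (add m f1 f2)
  then show ?case by (simp add: distrib_right deg_le.add)
next
  case (var i m f)
  then show ?case using deg_le.var[of i I "m + k" "\<lambda>c. f c * g c"] by (simp add: mult.assoc)
qed

lemma deg_le_sum: "(\<And>x. x \<in> S \<Longrightarrow> deg_le I m (f x)) \<Longrightarrow> deg_le I m (\<lambda>c. \<Sum>x\<in>S. f x c)"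
  by (induction S rule: infinite_finite_induct) (simp_all add: deg_le.const deg_le.add)

lemma deg_le_prod:
  "(\<And>x. x \<in> S \<Longrightarrow> deg_le I (m x) (f x)) \<Longrightarrow> deg_le I (\<Sum>x\<in>S. m x) (\<lambda>c. \<Prod>x\<in>S. f x c)"
  by (induction S rule: infinite_finite_induct) (simp_all add: deg_le.const deg_le_mult)

lemma deg_le_power: "deg_le I m f \<Longrightarrow> deg_le I (k * m) (\<lambda>c. f c ^ k)"
  by (induction k) (simp_all add: deg_le.const deg_le_mult)

text \<open>Carrying an auxiliary monomial along makes the induction over \<open>deg_le\<close> work.\<close>

lemma sum_deg_le_eq_0:
  fixes f :: "('i \<Rightarrow> 'a::{field,finite}) \<Rightarrow> 'a"
  assumes "deg_le I m f" "finite I" "m + (\<Sum>i\<in>I. e i) < card I * (CARD('a) - 1)"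
  shows "(\<Sum>c\<in>PiE I (\<lambda>_. UNIV). f c * (\<Prod>i\<in>I. c i ^ e i)) = 0"
  using assms
proof (induction arbitrary: e rule: deg_le.induct)
  case (const m a)
  \<comment> \<open>Pigeonhole: if all exponents reached \<open>CARD('a) - 1\<close>, their sum
    would reach the excluded bound.\<close>
  have "\<exists>i\<in>I. e i < CARD('a) - 1"
  proof (rule ccontr)
    assume "\<not> ?thesis"
    hence "card I * (CARD('a) - 1) \<le> (\<Sum>i\<in>I. e i)"
      using sum_bounded_below[of I "CARD('a) - 1" e] by (simp add: not_less)
    thus False using const by auto
  qed
  then obtain j where j: "j \<in> I" "e j < CARD('a) - 1" by blast
  have "(\<Sum>c\<in>PiE I (\<lambda>_. UNIV::'a set). \<Prod>i\<in>I. c i ^ e i) = (\<Prod>i\<in>I. \<Sum>t\<in>(UNIV::'a set). t ^ e i)"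
    using const by (intro prod_sum_PiE[symmetric]) auto
  also have "\<dots> = 0"
    using const j sum_power_field_eq_0 by (intro prod_zero) auto
  finally show ?case
    by (simp flip: sum_distrib_left)
next
  case (add m f g)
  then show ?case
    by (simp add: distrib_right sum.distrib)
next
  case (var i m f)
  \<comment> \<open>The factor \<open>c i\<close> moves from the function to the monomial, so that
    the degree bound plus the sum of the exponents stays the same.\<close>
  define e' where "e' = e(i := Suc (e i))"
  have "(\<Prod>j\<in>I. c j ^ e' j) = c i * (\<Prod>j\<in>I. c j ^ e j)" for c :: "'i \<Rightarrow> 'a"
    using var.hyps var.prems by (simp add: prod.remove[of I i] e'_def)
  hence "c i * f c * (\<Prod>j\<in>I. c j ^ e j) = f c * (\<Prod>j\<in>I. c j ^ e' j)" for c
    by (simp add: mult_ac)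
  moreover have "(\<Sum>j\<in>I. e' j) = Suc (\<Sum>j\<in>I. e j)"
    using var.hyps var.prems by (simp add: sum.remove[of I i] e'_def)
  ultimately show ?case
    using var.IH[of e'] var.prems by (simp only: add_Suc add_Suc_right)
qed

corollary chevalley_warning_sum:
  fixes f :: "('i \<Rightarrow> 'a::{field,finite}) \<Rightarrow> 'a"
  assumes "deg_le I m f" "finite I" "m < card I * (CARD('a) - 1)"
  shows "(\<Sum>c\<in>PiE I (\<lambda>_. UNIV). f c) = 0"
  using sum_deg_le_eq_0[of I m f "\<lambda>_. 0"] assms by simp

section \<open>Commuting matrices and invariant subspaces\<close>

lemma mat_mult_vec: "mat c *v x = c *s (x :: 'a::semiring_1 ^ 'n)"
  by (simp add: vec_eq_iff matrix_vector_mult_def mat_def if_distrib if_distribR sum.delta' cong: if_cong)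

lemma sum_matrix_vector_mult: "(\<Sum>i\<in>S. M i) *v x = (\<Sum>i\<in>S. M i *v x)"
  by (induction S rule: infinite_finite_induct) (simp_all add: matrix_vector_mult_add_rdistrib)

lemmas mv_simps = matrix_vector_mul_assoc[symmetric] matrix_vector_mult_add_rdistrib
  matrix_vector_mult_diff_rdistrib matrix_vector_right_distrib matrix_vector_mult_diff_distrib

lemma matrix_works_ex:
  fixes f :: "'a::field ^ 'n \<Rightarrow> 'a ^ 'm"
  assumes "Vector_Spaces.linear (*s) (*s) f"
  obtains A where "\<And>x. A *v x = f x"
  using matrix_works[OF assms] by blast

lemma invertible_iff_ker:
  fixes A :: "'a::field ^ 'n ^ 'n"
  shows "invertible A \<longleftrightarrow> (\<forall>x. A *v x = 0 \<longrightarrow> x = 0)"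
  by (simp add: invertible_left_inverse matrix_left_invertible_ker)

lemma det_nz_iff_ker:
  fixes A :: "'a::field ^ 'n ^ 'n"
  shows "det A \<noteq> 0 \<longleftrightarrow> (\<forall>x. A *v x = 0 \<longrightarrow> x = 0)"
  by (metis invertible_det_nz invertible_iff_ker)

definition commute :: "'a::semiring_1 ^ 'n ^ 'n \<Rightarrow> 'a ^ 'n ^ 'n \<Rightarrow> bool" where
  "commute A B \<longleftrightarrow> A ** B = B ** A"

lemma commute_sym: "commute A B \<Longrightarrow> commute B A"
  by (simp add: commute_def)

lemma commute_refl: "commute A A"
  by (simp add: commute_def)

lemma commute_mat: "commute A (mat c)" for A :: "'a::field ^ 'n ^ 'n"
  by (simp add: commute_def matrix_eq mat_mult_vec mv_simps vec.scale)

lemma commute_mult: "commute A B \<Longrightarrow> commute A C \<Longrightarrow> commute A (B ** C)"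
  unfolding commute_def by (metis matrix_mul_assoc)

lemma commute_add: "commute A B \<Longrightarrow> commute A C \<Longrightarrow> commute A (B + C)" for A :: "'a::field ^ 'n ^ 'n"
  by (simp add: commute_def matrix_eq mv_simps)

lemma commute_diff: "commute A B \<Longrightarrow> commute A C \<Longrightarrow> commute A (B - C)" for A :: "'a::field ^ 'n ^ 'n"
  by (simp add: commute_def matrix_eq mv_simps)

lemma commute_inverse:
  fixes A :: "'a::field ^ 'n ^ 'n"
  assumes "commute A B" "B ** C = mat 1"
  shows "commute A C"
proof -
  have CB: "C ** B = mat 1"
    using assms(2) matrix_left_right_inverse by blast
  have "A ** C = C ** B ** A ** C"
    by (simp add: CB)
  also have "\<dots> = C ** (A ** B) ** C"
    using assms(1) by (simp add: commute_def matrix_mul_assoc)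
  also have "\<dots> = C ** A ** (B ** C)"
    by (simp only: matrix_mul_assoc)
  also have "\<dots> = C ** A"
    using assms(2) by simp
  finally show ?thesis by (simp add: commute_def)
qed

lemma commuteD: "commute A B \<Longrightarrow> A *v (B *v x) = B *v (A *v x)"
  by (simp add: commute_def matrix_vector_mul_assoc)

lemmas commute_intros = commute_mat commute_mult commute_add commute_diff

section \<open>Matrix powers, projections and invariant subspaces\<close>

primrec mat_pow :: "'a::semiring_1 ^ 'n ^ 'n \<Rightarrow> nat \<Rightarrow> 'a ^ 'n ^ 'n" where
  "mat_pow A 0 = mat 1"
| "mat_pow A (Suc k) = A ** mat_pow A k"

lemma mat_pow_commute: "mat_pow A k ** A = A ** mat_pow A k"
  by (induction k) (simp_all add: matrix_mul_assoc[symmetric])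

lemma mat_pow_add: "mat_pow X (i + j) = mat_pow X i ** mat_pow X j"
  by (induction i) (simp_all add: matrix_mul_assoc[symmetric])

definition projection_onto :: "'a::field ^ 'n ^ 'n \<Rightarrow> ('a ^ 'n) set \<Rightarrow> bool" where
  "projection_onto P S \<longleftrightarrow> (\<forall>v. P *v v \<in> S) \<and> (\<forall>v\<in>S. P *v v = v)"

lemma projection_onto_range: "projection_onto P (range ((*v) P)) \<longleftrightarrow> P ** P = P"
  by (auto simp: projection_onto_def matrix_eq mv_simps)

lemma projection_onto_idem: "projection_onto P S \<Longrightarrow> P ** P = P"
  by (auto simp: projection_onto_def matrix_eq mv_simps)

lemma projection_onto_image: "projection_onto P S \<Longrightarrow> S = range ((*v) P)"
  by (auto simp: projection_onto_def intro: range_eqI[OF sym])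

lemma exists_projection:
  fixes S :: "('a::field ^ 'n) set"
  assumes "vec.subspace S"
  shows "\<exists>P. projection_onto P S"
proof -
  have "Vector_Spaces.linear (*s) (*s) (\<lambda>x::'a^'n. x)"
    by (rule vec.linear_ident)
  \<comment> \<open>A linear left inverse on \<open>S\<close> of the identity map, with values in
    \<open>S\<close>, is a projection onto \<open>S\<close>.\<close>
  from vec.linear_exists_left_inverse_on[OF this assms]
  obtain g where g: "g ` UNIV \<subseteq> S" "Vector_Spaces.linear (*s) (*s) g" "\<forall>v\<in>S. g v = v"
    by auto
  obtain P where "\<And>x. P *v x = g x"
    using matrix_works_ex[OF g(2)] by blast
  then show ?thesis
    using g by (intro exI[of _ P]) (auto simp: projection_onto_def)
qed

definition invariant_subspace :: "'a::field ^ 'n ^ 'n \<Rightarrow> ('a ^ 'n) set \<Rightarrow> bool" where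
  "invariant_subspace X S \<longleftrightarrow> vec.subspace S \<and> (\<forall>v\<in>S. X *v v \<in> S)"

definition irreducible_subspace :: "'a::field ^ 'n ^ 'n \<Rightarrow> ('a ^ 'n) set \<Rightarrow> bool" where
  "irreducible_subspace X U \<longleftrightarrow> invariant_subspace X U \<and> U \<noteq> {0} \<and>
     (\<forall>S. invariant_subspace X S \<and> S \<subseteq> U \<longrightarrow> S = {0} \<or> S = U)"

lemma invariant_subspace_range: "commute X A \<Longrightarrow> invariant_subspace X (range ((*v) A))"
  unfolding invariant_subspace_def
  by (auto simp: commuteD intro: vec.subspace_image)

lemma invariant_subspace_ker_Int:
  assumes "commute X A" "invariant_subspace X U"
  shows "invariant_subspace X {v\<in>U. A *v v = 0}"
proof -
  have "vec.subspace {v. A *v v = 0}"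
    by (rule vec.linear_subspace_kernel) simp
  moreover have "{v\<in>U. A *v v = 0} = U \<inter> {v. A *v v = 0}" by auto
  ultimately have "vec.subspace {v\<in>U. A *v v = 0}"
    using assms(2) vec.subspace_inter by (metis invariant_subspace_def)
  then show ?thesis
    using assms by (auto simp: invariant_subspace_def simp flip: commuteD[of X A])
qed

text \<open>Half of Schur's lemma: the kernel of \<open>A\<close> in \<open>U\<close> is a
  submodule, and it is proper because of \<open>u\<close>. The image of \<open>U\<close> under
  \<open>A\<close> may lie outside \<open>U\<close>.\<close>

lemma irreducible_subspace_ker:
  assumes "irreducible_subspace X U" "commute X A" "u \<in> U" "A *v u \<noteq> 0" "v \<in> U" "A *v v = 0"
  shows "v = 0"
proof -
  have "invariant_subspace X {v\<in>U. A *v v = 0}"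
    using assms invariant_subspace_ker_Int irreducible_subspace_def by blast
  then have "{v\<in>U. A *v v = 0} = {0} \<or> {v\<in>U. A *v v = 0} = U"
    using assms(1) unfolding irreducible_subspace_def by blast
  then show ?thesis
    using assms by blast
qed

text \<open>Over a finite field one can take a nonzero invariant subspace with the fewest
  elements.\<close>

lemma exists_irreducible_subspace:
  fixes X :: "'a::{field,finite} ^ 'n ^ 'n"
  shows "\<exists>U. irreducible_subspace X U"
proof -
  let ?P = "\<lambda>S. invariant_subspace X S \<and> S \<noteq> {0}"
  have "(1 :: 'a^'n) \<noteq> 0" by (simp add: vec_eq_iff)
  then have "?P UNIV"
    unfolding invariant_subspace_def by (metis UNIV_I singletonD vec.subspace_UNIV)
  then obtain U where U: "?P U" "\<And>S. ?P S \<Longrightarrow> card U \<le> card S"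
    using ex_has_least_nat[of ?P UNIV card] by blast
  have "S = U" if "invariant_subspace X S" "S \<subseteq> U" "S \<noteq> {0}" for S
    using U(2)[of S] that by (simp add: card_seteq)
  then show ?thesis
    using U(1) unfolding irreducible_subspace_def by blast
qed

text \<open>An arbitrary projection onto \<open>S\<close> is averaged over the powers of
  \<open>X\<close>; in the sum, exponent \<open>N - i\<close> stands for the inverse of the
  \<open>i\<close>-th power.\<close>

theorem maschke:
  fixes X :: "'a::field ^ 'n ^ 'n"
  assumes S: "invariant_subspace X S" and N: "mat_pow X N = mat 1" "of_nat N \<noteq> (0::'a)"
  shows "\<exists>P. projection_onto P S \<and> commute X P"
proof -
  obtain P0 where P0: "projection_onto P0 S"
    using exists_projection S by (auto simp: invariant_subspace_def)
  define A where "A = (\<Sum>i<N. mat_pow X i ** P0 ** mat_pow X (N - i))"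
  define P where "P = mat (1 / of_nat N) ** A"
  have pow: "mat_pow X i *v v \<in> S" if "v \<in> S" for i v
    using that S by (induction i) (auto simp: invariant_subspace_def mv_simps)
  have powN: "mat_pow X i *v (mat_pow X (N - i) *v v) = v" if "i \<le> N" for i v
  proof -
    have "mat_pow X i ** mat_pow X (N - i) = mat 1"
      using that N(1) by (simp flip: mat_pow_add)
    then show ?thesis
      by (simp add: matrix_vector_mul_assoc)
  qed
  have A_in: "A *v v \<in> S" for v
    unfolding A_def sum_matrix_vector_mult
    using S P0 pow by (intro vec.subspace_sum)
      (auto simp: invariant_subspace_def projection_onto_def mv_simps)
  have A_id: "A *v v = of_nat N *s v" if "v \<in> S" for v
  proof -
    have "(mat_pow X i ** P0 ** mat_pow X (N - i)) *v v = v" if "i < N" for i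
      using that \<open>v \<in> S\<close> P0 pow powN[of i v] by (simp add: projection_onto_def mv_simps)
    then have "A *v v = (\<Sum>i<N. v)"
      unfolding A_def sum_matrix_vector_mult by simp
    moreover have "(\<Sum>i<k. v) = of_nat k *s v" for k :: nat
      by (induction k) (simp_all add: vec.scale_left_distrib add.commute del: sum_constant)
    ultimately show ?thesis by simp
  qed
  have "commute X A"
  proof -
    \<comment> \<open>Multiplying the average by \<open>X\<close> on the left or on the right gives
      the same sum of terms \<open>g i\<close> up to a shift of the index. The end terms
      \<open>g 0\<close> and \<open>g N\<close> agree because the \<open>N\<close>-th power of
      \<open>X\<close> is \<open>1\<close>.\<close>
    define g where "g i = mat_pow X i ** P0 ** mat_pow X (Suc N - i)" for i
    have "X *v (A *v v) = A *v (X *v v)" for v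
    proof -
      have "X *v (A *v v) = (\<Sum>i<N. g (Suc i) *v v)"
        unfolding A_def sum_matrix_vector_mult g_def vec.sum
        by (intro sum.cong) (simp_all add: mv_simps)
      moreover have "A *v (X *v v) = (\<Sum>i<N. g i *v v)"
        unfolding A_def sum_matrix_vector_mult g_def
        by (intro sum.cong)
           (simp_all add: Suc_diff_le mat_pow_commute[symmetric] matrix_vector_mul_assoc matrix_mul_assoc)
      moreover have "(\<Sum>i<N. g (Suc i) *v v) + g 0 *v v = (\<Sum>i<N. g i *v v) + g N *v v"
        using sum.lessThan_Suc_shift[of "\<lambda>i. g i *v v" N] sum.lessThan_Suc[of "\<lambda>i. g i *v v" N]
        by (simp add: add.commute)
      moreover have "g 0 = g N"
        using N by (simp add: g_def)
      ultimately show ?thesis by simp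
    qed
    then show ?thesis
      by (simp add: commute_def matrix_eq mv_simps)
  qed
  then have "commute X P"
    unfolding P_def by (intro commute_intros)
  moreover have "projection_onto P S"
    using A_in A_id N(2) S unfolding P_def projection_onto_def
    by (auto simp: mv_simps mat_mult_vec invariant_subspace_def vec.subspace_scale)
  ultimately show ?thesis by blast
qed

section \<open>Reflexive forms and adjoints\<close>

lemma invertible_matrix_inv:
  assumes "invertible A"
  shows "A ** matrix_inv A = mat 1" "matrix_inv A ** A = mat 1"
  using someI_ex[OF assms[unfolded invertible_def]] unfolding matrix_inv_def by auto

lemma det_map_matrix:
  fixes \<sigma> :: "'a::comm_ring_1 \<Rightarrow> 'a"
  assumes add: "\<And>x y. \<sigma> (x + y) = \<sigma> x + \<sigma> y" and mult: "\<And>x y. \<sigma> (x * y) = \<sigma> x * \<sigma> y"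
    and one: "\<sigma> 1 = 1"
  shows "det (map_matrix \<sigma> (A :: 'a ^ 'n ^ 'n)) = \<sigma> (det A)"
proof -
  have zero: "\<sigma> 0 = 0"
    using add[of 0 0] by simp
  have minus: "\<sigma> (- x) = - \<sigma> x" for x
    using add[of x "- x"] zero by (simp add: eq_neg_iff_add_eq_0 add.commute)
  have sum: "\<sigma> (\<Sum>x\<in>S. f x) = (\<Sum>x\<in>S. \<sigma> (f x))" for S and f :: "('n \<Rightarrow> 'n) \<Rightarrow> 'a"
    by (induction S rule: infinite_finite_induct) (simp_all add: zero add)
  have prod: "\<sigma> (\<Prod>x\<in>S. f x) = (\<Prod>x\<in>S. \<sigma> (f x))" for S and f :: "'n \<Rightarrow> 'a"
    by (induction S rule: infinite_finite_induct) (simp_all add: one mult)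
  have "\<sigma> (of_int (sign p)) = of_int (sign p)" for p :: "'n \<Rightarrow> 'n"
    by (simp add: sign_def one minus)
  then show ?thesis
    unfolding det_def by (simp add: sum prod mult)
qed

text \<open>Hermitian, symmetric and alternating forms (in odd characteristic) are the cases \<open>\<sigma> x = x\<^sup>q\<close>, \<open>\<epsilon> = 1\<close>;
  \<open>\<sigma> = id\<close>, \<open>\<epsilon> = 1\<close>; \<open>\<sigma> = id\<close>, \<open>\<epsilon> = -1\<close>.\<close>

locale reflexive_form =
  fixes \<sigma> :: "'a::field \<Rightarrow> 'a" and \<epsilon> :: 'a and \<beta> :: "'a ^ 'n \<Rightarrow> 'a ^ 'n \<Rightarrow> 'a"
  assumes \<sigma>_add: "\<sigma> (x + y) = \<sigma> x + \<sigma> y"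
    and \<sigma>_mult: "\<sigma> (x * y) = \<sigma> x * \<sigma> y"
    and \<sigma>_1: "\<sigma> 1 = 1"
    and \<sigma>_invol: "\<sigma> (\<sigma> x) = x"
    and add_left: "\<beta> (u + u') v = \<beta> u v + \<beta> u' v"
    and scale_left: "\<beta> (c *s u) v = c * \<beta> u v"
    and swap: "\<beta> v u = \<epsilon> * \<sigma> (\<beta> u v)"
    and nondeg: "(\<And>v. \<beta> u v = 0) \<Longrightarrow> u = 0"
begin

lemma \<sigma>_0: "\<sigma> 0 = 0"
  using \<sigma>_add[of 0 0] by (metis add.right_neutral add_left_cancel)

lemma add_right: "\<beta> u (v + v') = \<beta> u v + \<beta> u v'"
  by (subst (1 2 3) swap) (simp add: add_left \<sigma>_add distrib_left)

lemma scale_right: "\<beta> u (c *s v) = \<sigma> c * \<beta> u v"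
  by (subst (1 2) swap) (simp add: scale_left \<sigma>_mult)

lemma zero_left: "\<beta> 0 v = 0"
  using scale_left[of 0 0 v] by simp

lemma zero_right: "\<beta> u 0 = 0"
  using scale_right[of u 0 0] \<sigma>_0 by simp

lemma diff_left: "\<beta> (u - u') v = \<beta> u v - \<beta> u' v"
  using add_left[of "u - u'" u' v] by simp

lemma diff_right: "\<beta> u (v - v') = \<beta> u v - \<beta> u v'"
  using add_right[of u "v - v'" v'] by simp

lemma sum_left: "\<beta> (\<Sum>i\<in>S. f i) v = (\<Sum>i\<in>S. \<beta> (f i) v)"
  by (induction S rule: infinite_finite_induct) (simp_all add: zero_left add_left)

lemma sum_right: "\<beta> u (\<Sum>i\<in>S. f i) = (\<Sum>i\<in>S. \<beta> u (f i))"
  by (induction S rule: infinite_finite_induct) (simp_all add: zero_right add_right)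

lemma orthogonal_sym: "\<beta> u v = 0 \<Longrightarrow> \<beta> v u = 0"
  by (subst swap) (simp add: \<sigma>_0)

text \<open>Nondegeneracy is assumed in the left argument; the symmetry of orthogonality carries it
  to the right one.\<close>

lemma ext_right: "(\<And>u. \<beta> u x = \<beta> u y) \<Longrightarrow> x = y"
proof -
  assume "\<And>u. \<beta> u x = \<beta> u y"
  then have "\<beta> u (x - y) = 0" for u
    by (simp add: diff_right)
  then show "x = y"
    using nondeg[of "x - y"] orthogonal_sym by auto
qed

section \<open>Gram matrix, adjoint and isometries\<close>

definition gram :: "'a ^ 'n ^ 'n" where
  "gram = (\<chi> i j. \<beta> (axis i 1) (axis j 1))"

text \<open>The form is \<open>u\<^sup>T gram \<sigma>(v)\<close>. Moving \<open>A\<close> to the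
  right-hand argument conjugates its transpose by \<open>gram\<close>, and the outer \<sigma> makes
  up for the one applied to \<open>v\<close>. The explicit formula gives access to the
  determinant.\<close>

definition adj :: "'a ^ 'n ^ 'n \<Rightarrow> 'a ^ 'n ^ 'n" where
  "adj A = map_matrix \<sigma> (matrix_inv gram ** transpose A ** gram)"

lemma form_gram: "\<beta> u v = (\<Sum>i\<in>UNIV. u $ i * (gram *v (\<chi> j. \<sigma> (v $ j))) $ i)"
proof -
  have "\<beta> u v = \<beta> (\<Sum>i\<in>UNIV. u $ i *s axis i 1) (\<Sum>j\<in>UNIV. v $ j *s axis j 1)"
    by (simp add: basis_expansion)
  also have "\<dots> = (\<Sum>i\<in>UNIV. u $ i * (\<Sum>j\<in>UNIV. \<sigma> (v $ j) * gram $ i $ j))"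
    unfolding sum_left scale_left unfolding sum_right scale_right
    by (simp add: gram_def sum_distrib_left)
  finally show ?thesis
    by (simp add: matrix_vector_mult_def mult.commute)
qed

text \<open>Applying \<sigma> to the entries of a kernel vector of \<open>gram\<close> yields a
  vector orthogonal to the whole space.\<close>

lemma gram_invertible: "invertible gram"
proof -
  have "w = 0" if "gram *v w = 0" for w
  proof -
    define v where "v = (\<chi> j. \<sigma> (w $ j))"
    have "(\<chi> j. \<sigma> (v $ j)) = w"
      by (simp add: v_def \<sigma>_invol)
    then have "\<beta> u v = 0" for u
      using that by (simp add: form_gram)
    then have "v = 0"
      using ext_right[of v 0] by (simp add: zero_right)
    then have "\<sigma> (w $ j) = 0" for j
      by (simp add: v_def vec_eq_iff)
    then show ?thesis
      by (metis \<sigma>_0 \<sigma>_invol vec_eq_iff zero_index)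
  qed
  then show ?thesis
    by (simp add: invertible_iff_ker)
qed

lemma adj: "\<beta> (A *v u) v = \<beta> u (adj A *v v)"
proof -
  define w where "w = (\<chi> j. \<sigma> (v $ j))"
  have sum: "\<sigma> (\<Sum>x\<in>S. f x) = (\<Sum>x\<in>S. \<sigma> (f x))" for S and f :: "'n \<Rightarrow> 'a"
    by (induction S rule: infinite_finite_induct) (simp_all add: \<sigma>_0 \<sigma>_add)
  have "(\<chi> j. \<sigma> ((adj A *v v) $ j)) = (matrix_inv gram ** transpose A ** gram) *v w"
    by (simp add: adj_def w_def vec_eq_iff matrix_vector_mult_def sum \<sigma>_mult \<sigma>_invol)
  then have "gram *v (\<chi> j. \<sigma> ((adj A *v v) $ j)) = (gram ** matrix_inv gram) ** transpose A ** gram *v w"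
    by (simp add: matrix_vector_mul_assoc matrix_mul_assoc)
  also have "\<dots> = transpose A *v (gram *v w)"
    using gram_invertible by (simp add: invertible_matrix_inv matrix_vector_mul_assoc)
  finally have "\<beta> u (adj A *v v) = (\<Sum>i\<in>UNIV. u $ i * (transpose A *v (gram *v w)) $ i)"
    by (simp only: form_gram)
  also have "\<dots> = (\<Sum>i\<in>UNIV. \<Sum>j\<in>UNIV. u $ i * (A $ j $ i * (gram *v w) $ j))"
    unfolding matrix_vector_mult_def[of "transpose A"] by (simp add: transpose_def sum_distrib_left)
  also have "\<dots> = (\<Sum>j\<in>UNIV. \<Sum>i\<in>UNIV. u $ i * (A $ j $ i * (gram *v w) $ j))"
    by (rule sum.swap)
  also have "\<dots> = (\<Sum>j\<in>UNIV. (A *v u) $ j * (gram *v w) $ j)"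
    by (simp add: matrix_vector_mult_def[of A] sum_distrib_left sum_distrib_right mult_ac)
  also have "\<dots> = \<beta> (A *v u) v"
    by (simp add: form_gram w_def)
  finally show ?thesis by simp
qed

text \<open>Transposition and conjugation by \<open>gram\<close> keep the determinant, and the ring
  homomorphism \<sigma> passes through the Leibniz formula.\<close>

lemma det_adj: "det (adj A) = \<sigma> (det A)"
proof -
  have "det (matrix_inv gram) * det gram = 1"
    using gram_invertible by (metis det_I det_mul invertible_matrix_inv(2))
  then have "det (matrix_inv gram ** transpose A ** gram) = det A"
    by (simp add: det_mul mult_ac)
  then show ?thesis
    by (simp add: adj_def det_map_matrix \<sigma>_add \<sigma>_mult \<sigma>_1)
qed

text \<open>Uniqueness of the adjoint; the algebraic rules for \<open>adj\<close> follow from it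
  without matrix entries.\<close>

lemma adj_eqI: "(\<And>u v. \<beta> (A *v u) v = \<beta> u (B *v v)) \<Longrightarrow> adj A = B"
  by (simp add: matrix_eq ext_right adj)

lemma adj_mult: "adj (A ** B) = adj B ** adj A"
  by (rule adj_eqI) (simp add: mv_simps adj)

lemma adj_add: "adj (A + B) = adj A + adj B"
  by (rule adj_eqI) (simp add: mv_simps adj add_left add_right)

lemma adj_diff: "adj (A - B) = adj A - adj B"
  by (rule adj_eqI) (simp add: mv_simps adj diff_left diff_right)

lemma adj_1: "adj (mat 1) = mat 1"
  by (rule adj_eqI) simp

lemma adj_0: "adj 0 = 0"
  by (rule adj_eqI) (simp add: zero_left zero_right)

lemma adj_right: "\<beta> u (A *v v) = \<beta> (adj A *v u) v"
  by (subst (1 2) swap) (simp add: adj)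

lemma adj_adj: "adj (adj A) = A"
  by (rule adj_eqI) (simp add: adj_right)

lemma adj_commute: "commute A B \<Longrightarrow> commute (adj A) (adj B)"
  by (simp add: commute_def flip: adj_mult)

definition isometry :: "'a ^ 'n ^ 'n \<Rightarrow> bool" where
  "isometry A \<longleftrightarrow> (\<forall>u v. \<beta> (A *v u) (A *v v) = \<beta> u v)"

lemma isometry_iff: "isometry A \<longleftrightarrow> adj A ** A = mat 1"
proof
  assume "isometry A"
  then have "\<beta> u ((adj A ** A) *v v) = \<beta> u v" for u v
    by (simp add: isometry_def mv_simps flip: adj)
  then show "adj A ** A = mat 1"
    by (simp add: matrix_eq ext_right)
next
  assume "adj A ** A = mat 1"
  then show "isometry A"
    by (metis adj isometry_def matrix_vector_mul_assoc matrix_vector_mul_lid)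
qed

lemma isometry_iff': "isometry A \<longleftrightarrow> A ** adj A = mat 1"
  unfolding isometry_iff by (rule matrix_left_right_inverse)

lemma isometry_mult: "isometry A \<Longrightarrow> isometry B \<Longrightarrow> isometry (A ** B)"
  by (simp add: isometry_def mv_simps)

lemma isometry_inverse: "isometry A \<Longrightarrow> isometry (adj A)"
  by (simp add: isometry_iff'[of A] isometry_iff[of "adj A"] adj_adj)

lemma isometry_invertible: "isometry A \<Longrightarrow> invertible A"
  using invertible_def isometry_iff isometry_iff' by blast

lemma isometry_det: "isometry A \<Longrightarrow> \<sigma> (det A) * det A = 1"
  by (metis isometry_iff det_I det_adj det_mul)

text \<open>The adjoint of \<open>X\<close> is its inverse. Taking adjoints shows that
  \<open>adj A\<close> commutes with this inverse, hence with \<open>X\<close>.\<close>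

lemma commute_adj_isometry: "isometry X \<Longrightarrow> commute X A \<Longrightarrow> commute X (adj A)"
  by (metis adj_commute commute_inverse commute_sym isometry_iff)

end

section \<open>Determinants on the bicommutant\<close>

lemma matrix_vector_mult_axis: "(A *v axis j 1) $ k = A $ k $ (j :: 'n)" for A :: "'a::field ^ 'n ^ 'm"
  by (simp add: matrix_vector_mult_def axis_def if_distrib cong: if_cong)

lemma matrix_vector_mult_axis_column: "A *v axis j 1 = column j A" for A :: "'a::field ^ 'n ^ 'm"
  by (simp add: vec_eq_iff matrix_vector_mult_axis column_def)

text \<open>Extend \<open>b\<close> to a basis, index it by \<open>'n\<close> and use its elements
  as columns; \<open>I\<close> collects the indices of the columns in \<open>b\<close>.\<close>

lemma exists_adapted_basis:
  fixes b :: "('a::field ^ 'n) set"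
  assumes "vec.independent b"
  obtains B :: "'a ^ 'n ^ 'n" and I where "invertible B" "bij_betw (\<lambda>i. column i B) I b"
proof -
  define c where "c = vec.extend_basis b"
  have c: "b \<subseteq> c" "vec.independent c" "vec.span c = UNIV"
    using vec.extend_basis_superset[OF assms] vec.independent_extend_basis[OF assms]
      vec.span_extend_basis[OF assms] by (auto simp: c_def)
  have fin: "finite c"
    using c(2) by (rule vec.finiteI_independent)
  have "card c = CARD('n)"
    using c vec.dim_eq_card[of c UNIV] vec_dim_card by (metis vec.span_UNIV)
  then obtain f where f: "bij_betw f (UNIV :: 'n set) c"
    using finite_same_card_bij[of "UNIV :: 'n set" c] fin by auto
  define B where "B = (\<chi> i j. f j $ i)"
  have col: "column j B = f j" for j
    by (simp add: B_def column_def)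
  have "columns B = c"
    using f by (auto simp: columns_def col bij_betw_def)
  then have "invertible B"
    using c(3) by (simp add: invertible_right_inverse matrix_right_invertible_span_columns)
  moreover have "bij_betw (\<lambda>i. column i B) (f -` b) b"
    unfolding col using f c(1)
    by (auto simp: bij_betw_def inj_on_def)
  ultimately show ?thesis by (rule that)
qed

text \<open>Turns \<open>U\<close> into a coordinate subspace, so that \<open>card I\<close> serves
  as its dimension in the degree bound for determinants.\<close>

lemma exists_adapted_coordinates:
  fixes U :: "('a::field ^ 'n) set"
  assumes "vec.subspace U"
  obtains B :: "'a ^ 'n ^ 'n" and I
  where "invertible B" "\<And>x. B *v x \<in> U \<longleftrightarrow> (\<forall>i. i \<notin> I \<longrightarrow> x $ i = 0)"
proof -
  obtain b where b: "b \<subseteq> U" "vec.independent b" "U \<subseteq> vec.span b"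
    using vec.basis_exists[of U] by metis
  then have span: "U = vec.span b"
    using assms vec.span_minimal by blast
  obtain B :: "'a ^ 'n ^ 'n" and I where B: "invertible B" "bij_betw (\<lambda>i. column i B) I b"
    using exists_adapted_basis[OF b(2)] by blast
  have expand: "B *v x = (\<Sum>i\<in>I. x $ i *s column i B)" if "\<forall>i. i \<notin> I \<longrightarrow> x $ i = 0" for x
    unfolding matrix_mult_sum using that by (intro sum.mono_neutral_right) auto
  have "B *v x \<in> U \<longleftrightarrow> (\<forall>i. i \<notin> I \<longrightarrow> x $ i = 0)" for x
  proof
    assume "\<forall>i. i \<notin> I \<longrightarrow> x $ i = 0"
    then have "B *v x = (\<Sum>i\<in>I. x $ i *s column i B)"
      by (rule expand)
    also have "\<dots> \<in> U"
      using B(2) b(1) assms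
      by (intro vec.subspace_sum vec.subspace_scale) (auto simp: bij_betw_def)
    finally show "B *v x \<in> U" .
  next
    assume "B *v x \<in> U"
    then have "B *v x \<in> vec.span b"
      by (simp add: span)
    then obtain g where "B *v x = (\<Sum>v\<in>b. g v *s v)"
      using vec.span_finite[OF vec.finiteI_independent[OF b(2)]] by auto
    also have "\<dots> = (\<Sum>i\<in>I. g (column i B) *s column i B)"
      using sum.reindex_bij_betw[OF B(2), of "\<lambda>v. g v *s v"] by simp
    \<comment> \<open>The coefficients are padded by zero outside \<open>I\<close>, so that
      \<open>expand\<close> applies in reverse.\<close>
    also have "\<dots> = (\<Sum>i\<in>I. (\<chi> i. if i \<in> I then g (column i B) else 0) $ i *s column i B)"
      by (intro sum.cong) auto
    also have "\<dots> = B *v (\<chi> i. if i \<in> I then g (column i B) else 0)"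
      by (rule expand[symmetric]) simp
    finally have "B *v x = B *v (\<chi> i. if i \<in> I then g (column i B) else 0)" .
    then have "x = (\<chi> i. if i \<in> I then g (column i B) else 0)"
      using B(1) by (metis inj_matrix_vector_mult injD)
    then show "\<forall>i. i \<notin> I \<longrightarrow> x $ i = 0"
      by (simp add: vec_eq_iff)
  qed
  then show ?thesis
    using B(1) that by blast
qed

lemma det_conjugate:
  fixes A B :: "'a::field ^ 'n ^ 'n"
  assumes "invertible B"
  shows "det (matrix_inv B ** A ** B) = det A"
proof -
  have "det (matrix_inv B) * det B = 1"
    using assms by (metis det_I det_mul invertible_matrix_inv(2))
  then show ?thesis
    by (simp add: det_mul mult_ac)
qed

text \<open>In a basis that contains \<open>v\<close>, say at position \<open>i\<close>, the matrix
  differs from the identity in row \<open>i\<close> only, and its diagonal entry there is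
  \<open>1 + f v\<close>.\<close>

lemma det_rank_one_perturbation:
  fixes A :: "'a::field ^ 'n ^ 'n"
  assumes A: "\<And>u. A *v u = u + f u *s v" and v: "v \<noteq> 0"
  shows "det A = 1 + f v"
proof -
  have "vec.independent {v}"
    using v by (simp add: vec.independent_insert)
  then obtain B :: "'a ^ 'n ^ 'n" and I where B: "invertible B" "bij_betw (\<lambda>i. column i B) I {v}"
    using exists_adapted_basis by blast
  obtain i where "i \<in> I" "column i B = v"
    using bij_betw_imp_surj_on[OF B(2)] by (metis imageE insertI1)
  then have i: "B *v axis i 1 = v"
    by (simp add: matrix_vector_mult_axis_column)
  then have inv_v: "matrix_inv B *v v = axis i 1"
    using invertible_matrix_inv(2)[OF B(1)] by (metis matrix_vector_mul_assoc matrix_vector_mul_lid)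
  define C where "C = matrix_inv B ** A ** B"
  have "C *v axis j 1 = axis j 1 + f (B *v axis j 1) *s axis i 1" for j
    using invertible_matrix_inv(2)[OF B(1)]
    by (simp add: C_def mv_simps A vec.scale inv_v) (simp add: matrix_vector_mul_assoc)
  then have C: "C $ k $ j = axis j 1 $ k + f (B *v axis j 1) * axis i 1 $ k" for k j
    by (metis matrix_vector_mult_axis vector_add_component vector_smult_component)
  have "det C = (\<Sum>p\<in>{id}. of_int (sign p) * (\<Prod>k\<in>UNIV. C $ k $ p k))"
    unfolding det_def
  proof (intro sum.mono_neutral_right ballI)
    fix p assume p: "p \<in> {p. p permutes (UNIV :: 'n set)} - {id}"
    \<comment> \<open>A permutation that fixes every index except possibly \<open>i\<close> is the
      identity. Any other one therefore meets an off-diagonal zero in some row different from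
      \<open>i\<close>.\<close>
    have "\<exists>k. k \<noteq> i \<and> p k \<noteq> k"
    proof (rule ccontr)
      assume "\<not> ?thesis"
      then have fix_k: "p k = k" if "k \<noteq> i" for k
        using that by blast
      have "p permutes UNIV" using p by blast
      then have "p i = i"
        using fix_k by (metis permutes_def)
      then have "p = id"
        using fix_k by (metis eq_id_iff)
      then show False using p by simp
    qed
    then obtain k where "k \<noteq> i" "p k \<noteq> k" by blast
    then have "C $ k $ p k = 0"
      by (simp add: C axis_def)
    then show "of_int (sign p) * (\<Prod>k\<in>UNIV. C $ k $ p k) = 0"
      by (auto intro: prod_zero)
  qed (auto simp: permutes_id)
  also have "\<dots> = (\<Prod>k\<in>UNIV. C $ k $ k)"
    by simp
  also have "\<dots> = (\<Prod>k\<in>UNIV. if k = i then 1 + f v else 1)"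
    by (intro prod.cong) (auto simp: C i, auto simp: axis_def)
  also have "\<dots> = 1 + f v"
    by simp
  finally show ?thesis
    using det_conjugate[OF B(1), of A] by (simp add: C_def)
qed

text \<open>Polynomials in \<open>X\<close> have this property. It is what the argument uses, since
  it makes \<open>a\<close> commute with \<open>P\<close>, \<open>adj P\<close> and
  \<open>adj a\<close>.\<close>

definition bicommutant :: "'a::field ^ 'n ^ 'n \<Rightarrow> 'a ^ 'n ^ 'n \<Rightarrow> bool" where
  "bicommutant X a \<longleftrightarrow> (\<forall>B. commute X B \<longrightarrow> commute a B)"

lemma bicommutant_intros:
  "bicommutant X X" "bicommutant X (mat c)"
  "bicommutant X a \<Longrightarrow> bicommutant X b \<Longrightarrow> bicommutant X (a ** b)"
  "bicommutant X a \<Longrightarrow> bicommutant X b \<Longrightarrow> bicommutant X (a + b)"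
  unfolding bicommutant_def by (blast intro: commute_sym commute_intros)+

lemma bicommutant_sum: "(\<And>i. i \<in> S \<Longrightarrow> bicommutant X (a i)) \<Longrightarrow> bicommutant X (\<Sum>i\<in>S. a i)"
proof (induction S rule: infinite_finite_induct)
  have "bicommutant X 0"
    using bicommutant_intros(2)[of X 0] by simp
  { case infinite then show ?case using \<open>bicommutant X 0\<close> by simp }
  { case empty then show ?case using \<open>bicommutant X 0\<close> by simp }
qed (auto intro: bicommutant_intros)

lemma bicommutant_commute: "bicommutant X a \<Longrightarrow> commute X a"
  unfolding bicommutant_def using commute_refl commute_sym by blast

text \<open>The images of \<open>u\<close> under the bicommutant form a nonzero submodule. It lies
  in \<open>U\<close> because the bicommutant commutes with \<open>P\<close>, so it is all of
  \<open>U\<close> by irreducibility.\<close>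

lemma bicommutant_cyclic:
  assumes U: "irreducible_subspace X U" and u: "u \<in> U" "u \<noteq> 0"
    and P: "projection_onto P U" "commute X P" and v: "v \<in> U"
  shows "\<exists>a. bicommutant X a \<and> a *v u = v"
proof -
  define S where "S = {a *v u | a. bicommutant X a}"
  have "S \<subseteq> U"
  proof
    fix w assume "w \<in> S"
    then obtain a where a: "bicommutant X a" "w = a *v u"
      by (auto simp: S_def)
    then have "P *v w = a *v (P *v u)"
      using P(2) by (metis bicommutant_def commuteD)
    then show "w \<in> U"
      using P(1) u(1) a(2) by (metis projection_onto_def)
  qed
  moreover have "invariant_subspace X S"
    unfolding invariant_subspace_def vec.subspace_def S_def
  proof (intro conjI ballI allI)
    show "0 \<in> {a *v u |a. bicommutant X a}"
      using bicommutant_intros(2)[of X 0] by (auto intro!: exI[of _ 0])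
    fix x y c assume "x \<in> {a *v u |a. bicommutant X a}" "y \<in> {a *v u |a. bicommutant X a}"
    then obtain a b where ab: "bicommutant X a" "x = a *v u" "bicommutant X b" "y = b *v u"
      by blast
    show "x + y \<in> {a *v u |a. bicommutant X a}"
      using ab by (auto intro!: exI[of _ "a + b"] bicommutant_intros simp: mv_simps)
    show "c *s x \<in> {a *v u |a. bicommutant X a}"
      using ab by (auto intro!: exI[of _ "mat c ** a"] bicommutant_intros simp: mv_simps mat_mult_vec)
    show "X *v x \<in> {a *v u |a. bicommutant X a}"
      using ab by (auto intro!: exI[of _ "X ** a"] bicommutant_intros simp: mv_simps)
  qed
  moreover have "u \<in> S"
    unfolding S_def by (rule CollectI, intro exI[of _ "mat 1"]) (simp add: bicommutant_intros)
  ultimately have "S = U"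
    using U u(2) unfolding irreducible_subspace_def by blast
  then show ?thesis
    using v by (auto simp: S_def)
qed

text \<open>Multiplication by \<open>x\<close> permutes \<open>H\<close>; compare the products of
  all elements before and after.\<close>

lemma finite_mult_closed_power_card:
  fixes H :: "'a::field set"
  assumes "finite H" "0 \<notin> H" "\<And>x y. x \<in> H \<Longrightarrow> y \<in> H \<Longrightarrow> x * y \<in> H" "x \<in> H"
  shows "x ^ card H = 1"
proof -
  have x: "x \<noteq> 0" using assms by blast
  then have inj: "inj_on ((*) x) H"
    by (simp add: inj_on_def)
  have "(*) x ` H = H"
    using assms by (intro endo_inj_surj inj) auto
  then have "(\<Prod>h\<in>H. h) = (\<Prod>h\<in>H. x * h)"
    using prod.reindex[OF inj, of "\<lambda>h. h"] by simp
  also have "\<dots> = x ^ card H * (\<Prod>h\<in>H. h)"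
    by (simp add: prod.distrib)
  finally show ?thesis
    using assms(1,2) by simp
qed

text \<open>The determinants occurring here form a subgroup \<open>H\<close> of the unit group. As a polynomial in \<open>dim U\<close>
  coordinates of \<open>a\<close>, the determinant has degree at most \<open>dim U\<close> and vanishes only at the origin, so if
  \<open>card H\<close> were less than \<open>CARD('a) - 1\<close>, the sum of all its \<open>card H\<close>-th powers would be both \<open>0\<close> and
  \<open>-1\<close>.\<close>

lemma exists_bicommutant_det:
  fixes X :: "'a::{field,finite} ^ 'n ^ 'n"
  assumes U: "irreducible_subspace X U" and P: "projection_onto P U" "commute X P" and "\<mu> \<noteq> 0"
  shows "\<exists>a. bicommutant X a \<and> det (mat 1 - P + a ** P) = \<mu>"
proof -
  \<comment> \<open>For \<open>a\<close> in the bicommutant this is the determinant of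
    \<open>a\<close> on \<open>U\<close>, as the matrix acts as the identity on the kernel of
    \<open>P\<close>.\<close>
  define D where "D a = det (mat 1 - P + a ** P)" for a
  define H where "H = {D a | a. bicommutant X a \<and> D a \<noteq> 0}"
  have sub: "vec.subspace U" and inv: "invariant_subspace X U"
    using U by (auto simp: irreducible_subspace_def invariant_subspace_def)
  have "U \<noteq> {0}" "0 \<in> U"
    using U sub by (auto simp: irreducible_subspace_def vec.subspace_0)
  then obtain u where u: "u \<in> U" "u \<noteq> 0" by blast
  have PP: "P *v (P *v x) = P *v x" and P_in: "P *v x \<in> U" and P_id: "x \<in> U \<Longrightarrow> P *v x = x" for x
    using P(1) by (simp_all add: projection_onto_def)
  have Pa: "P *v (a *v x) = a *v (P *v x)" if "bicommutant X a" for a x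
    using that P(2) commuteD unfolding bicommutant_def by metis

  have D_mult: "D a * D b = D (a ** b)" if "bicommutant X a" "bicommutant X b" for a b
  proof -
    have "(mat 1 - P + a ** P) ** (mat 1 - P + b ** P) = mat 1 - P + a ** b ** P"
      using that by (simp add: matrix_eq mv_simps PP Pa)
    then show ?thesis
      unfolding D_def by (metis det_mul)
  qed
  have H_mult: "x * y \<in> H" if "x \<in> H" "y \<in> H" for x y
    using that bicommutant_intros(3) unfolding H_def
    by (smt (verit, best) D_mult mem_Collect_eq mult_eq_0_iff)
  have "D (mat 1) = 1"
    by (simp add: D_def)
  then have "1 \<in> H"
    unfolding H_def using bicommutant_intros(2)[of X 1] by (intro CollectI exI[of _ "mat 1"]) simp
  have "finite H" "0 \<notin> H"
    by (auto simp: H_def)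
  then have H_pow: "x ^ card H = 1" if "x \<in> H" for x
    using finite_mult_closed_power_card H_mult that by blast
  have "card H > 0"
    using \<open>1 \<in> H\<close> \<open>finite H\<close> card_gt_0_iff by blast

  have "card H \<ge> CARD('a) - 1"
  proof (rule ccontr)
    assume less: "\<not> card H \<ge> CARD('a) - 1"
    obtain B :: "'a ^ 'n ^ 'n" and I
      where B: "invertible B" and BI: "\<And>x. B *v x \<in> U \<longleftrightarrow> (\<forall>i. i \<notin> I \<longrightarrow> x $ i = 0)"
      using exists_adapted_coordinates[OF sub] by blast
    define B' where "B' = matrix_inv B"
    have B': "B *v (B' *v x) = x" "B' *v (B *v x) = x" for x
      using invertible_matrix_inv[OF B] by (simp_all add: B'_def matrix_vector_mul_assoc)
    \<comment> \<open>Evaluation at \<open>u\<close> provides coordinates on the bicommutant: choose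
      \<open>a i\<close> that sends \<open>u\<close> to the \<open>i\<close>-th basis vector of
      \<open>U\<close>. Then \<open>s c\<close> sends \<open>u\<close> to the vector of
      \<open>U\<close> with coordinates \<open>c\<close>.\<close>
    have "\<forall>i\<in>I. \<exists>a. bicommutant X a \<and> a *v u = B *v axis i 1"
      using bicommutant_cyclic[OF U u P] BI by (auto simp: axis_def)
    then obtain a where a: "\<And>i. i \<in> I \<Longrightarrow> bicommutant X (a i)" "\<And>i. i \<in> I \<Longrightarrow> a i *v u = B *v axis i 1"
      by metis
    define s where "s c = (\<Sum>i\<in>I. mat (c i) ** a i)" for c
    have s: "bicommutant X (s c)" for c
      unfolding s_def using a by (intro bicommutant_sum bicommutant_intros) auto
    have su: "s c *v u = B *v (\<chi> i. if i \<in> I then c i else 0)" for c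
    proof -
      have "s c *v u = (\<Sum>i\<in>I. c i *s (B *v axis i 1))"
        unfolding s_def sum_matrix_vector_mult by (intro sum.cong) (simp_all add: mv_simps mat_mult_vec a)
      also have "\<dots> = B *v (\<Sum>i\<in>I. c i *s axis i 1)"
        by (simp add: vec.sum vec.scale)
      also have "(\<Sum>i\<in>I. c i *s axis i 1) = (\<chi> i. if i \<in> I then c i else 0)"
        by (simp add: vec_eq_iff axis_def if_distrib sum.delta cong: if_cong)
      finally show ?thesis .
    qed
    \<comment> \<open>If \<open>s c\<close> does not kill \<open>u\<close>, Schur's lemma makes it
      injective on \<open>U\<close>, and the determinant is nonzero.\<close>
    have D_eq_0: "D (s c) = 0 \<longleftrightarrow> (\<forall>i\<in>I. c i = 0)" for c
    proof
      assume "\<forall>i\<in>I. c i = 0"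
      then have "(\<chi> i. if i \<in> I then c i else 0) = 0"
        by (simp add: vec_eq_iff)
      then have "s c *v u = 0"
        by (simp add: su)
      then have "(mat 1 - P + s c ** P) *v u = 0"
        using u by (simp add: mv_simps P_id)
      then show "D (s c) = 0"
        unfolding D_def using det_nz_iff_ker u(2) by blast
    next
      assume D0: "D (s c) = 0"
      show "\<forall>i\<in>I. c i = 0"
      proof (rule ccontr)
        assume "\<not> ?thesis"
        then have "(\<chi> i. if i \<in> I then c i else 0) \<noteq> 0"
          by (auto simp: vec_eq_iff)
        then have su0: "s c *v u \<noteq> 0"
          using B'(2) by (metis su matrix_vector_mult_0_right)
        obtain x where x: "x \<noteq> 0" "(mat 1 - P + s c ** P) *v x = 0"
          using D0 det_nz_iff_ker unfolding D_def by blast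
        then have eq: "x - P *v x + s c *v (P *v x) = 0"
          by (simp add: mv_simps)
        then have "P *v (x - P *v x + s c *v (P *v x)) = 0"
          by simp
        then have "s c *v (P *v x) = 0"
          using Pa[OF s] by (simp add: mv_simps PP)
        then have "P *v x = 0"
          using irreducible_subspace_ker[OF U bicommutant_commute[OF s] u(1) su0 P_in] by blast
        then show False
          using eq x(1) by simp
      qed
    qed
    \<comment> \<open>In adapted coordinates each \<open>a i ** P\<close> has nonzero rows only in
      \<open>I\<close>, as its image lies in \<open>U\<close>. So the rows in \<open>I\<close> have
      degree at most one in \<open>c\<close>, the other rows are constant, and each Leibniz product
      has degree at most \<open>card I\<close>.\<close>
    have "deg_le I (card I) (\<lambda>c. D (s c))"
    proof -
      define M where "M c = B' ** (mat 1 - P + s c ** P) ** B" for c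
      define m0 where "m0 = B' ** (mat 1 - P) ** B"
      define m where "m i = B' ** (a i ** P) ** B" for i
      have "M c = m0 + (\<Sum>i\<in>I. mat (c i) ** m i)" for c
      proof -
        have "M c *v x = (m0 + (\<Sum>i\<in>I. mat (c i) ** m i)) *v x" for x
          by (simp add: M_def m0_def m_def s_def mv_simps sum_matrix_vector_mult vec.sum mat_mult_vec vec.scale)
        then show ?thesis by (simp add: matrix_eq)
      qed
      moreover have "(mat t ** C) $ k $ j = t * C $ k $ j" for t k j and C :: "'a ^ 'n ^ 'n"
        using matrix_vector_mult_axis[of "mat t ** C" j k] matrix_vector_mult_axis[of C j k]
        by (simp add: mv_simps mat_mult_vec)
      ultimately have entry: "M c $ k $ j = m0 $ k $ j + (\<Sum>i\<in>I. c i * m i $ k $ j)" for c k j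
        by (simp add: sum_component)
      have row0: "(B' ** C ** B) $ k $ j = 0" if "k \<notin> I" "\<And>x. C *v x \<in> U" for C k j
      proof -
        have "B *v ((B' ** C ** B) *v axis j 1) \<in> U"
          using that(2) by (simp add: mv_simps B')
        then show ?thesis
          using BI that(1) matrix_vector_mult_axis by metis
      qed
      have aP_in: "(a i ** P) *v x \<in> U" if "i \<in> I" for i x
        using Pa[OF a(1)[OF that], of x] P_in by (metis matrix_vector_mul_assoc)
      have entry_deg: "deg_le I (if k \<in> I then 1 else 0) (\<lambda>c. M c $ k $ j)" for k j
      proof (cases "k \<in> I")
        case True
        have "deg_le I 1 (\<lambda>c. c i * m i $ k $ j)" if "i \<in> I" for i
          using deg_le.var[OF that deg_le.const[of I 0 "m i $ k $ j"]] by simp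
        then show ?thesis
          using True unfolding entry by (simp add: deg_le.add deg_le.const deg_le_sum)
      next
        case False
        then have "M c $ k $ j = m0 $ k $ j" for c
          unfolding entry m_def using row0[OF False aP_in] by simp
        then show ?thesis
          using False by (simp add: deg_le.const)
      qed
      have "(\<Sum>k\<in>UNIV. if k \<in> I then 1 else 0) = card I"
        by (simp add: sum.If_cases)
      then have "deg_le I (card I) (\<lambda>c. \<Prod>k\<in>UNIV. M c $ k $ p k)" for p
        using deg_le_prod[of UNIV I "\<lambda>k. if k \<in> I then 1 else 0" "\<lambda>k c. M c $ k $ p k"] entry_deg
        by simp
      then have "deg_le I (card I) (\<lambda>c. det (M c))"
        unfolding det_def by (intro deg_le_sum deg_le_scale) auto
      moreover have "D (s c) = det (M c)" for c
        by (simp add: D_def M_def B'_def det_conjugate[OF B])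
      ultimately show ?thesis by simp
    qed
    then have deg: "deg_le I (card H * card I) (\<lambda>c. D (s c) ^ card H)"
      by (rule deg_le_power)
    \<comment> \<open>The strict degree comparisons below require at least one variable; an empty
      \<open>I\<close> would make \<open>U\<close> zero.\<close>
    have "I \<noteq> {}"
      using BI[of "B' *v u"] u B' by (metis empty_iff matrix_vector_mult_0_right vec_eq_iff zero_index)
    then have I: "card I > 0"
      by (simp add: card_gt_0_iff)
    let ?C = "PiE I (\<lambda>_. UNIV :: 'a set)"
    \<comment> \<open>The origin, written as a restricted function so that it belongs to
      \<open>?C\<close>.\<close>
    define z where "z = (\<lambda>i\<in>I. 0 :: 'a)"
    have z: "z \<in> ?C" by (simp add: z_def)
    have "D (s c) ^ card H = (if c = z then 0 else 1)" if "c \<in> ?C" for c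
    proof (cases "c = z")
      case True
      then show ?thesis using \<open>card H > 0\<close> D_eq_0[of c] by (simp add: z_def)
    next
      case False
      then have "D (s c) \<noteq> 0"
        using that D_eq_0[of c] by (auto simp: z_def PiE_def extensional_def)
      then have "D (s c) \<in> H"
        unfolding H_def using s by blast
      then show ?thesis using False H_pow by simp
    qed
    then have "(\<Sum>c\<in>?C. D (s c) ^ card H) = (\<Sum>c\<in>?C. if c = z then 0 else 1)"
      by (intro sum.cong) auto
    also have "\<dots> = (\<Sum>c\<in>?C. 1 - (if c = z then 1 else 0))"
      by (intro sum.cong) auto
    also have "\<dots> = (\<Sum>c\<in>?C. 1) - (\<Sum>c\<in>?C. if c = z then 1 else 0)"
      by (rule sum_subtractf)
    also have "(\<Sum>c\<in>?C. if c = z then 1 else 0 :: 'a) = 1"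
      using z by (simp add: finite_PiE)
    \<comment> \<open>A constant has degree \<open>0\<close>, so the power sum argument applies to
      it as well.\<close>
    also have "(\<Sum>c\<in>?C. 1 :: 'a) = 0"
      using chevalley_warning_sum[OF deg_le.const[of I 0 "1::'a"]] I less by simp
    also have "(\<Sum>c\<in>?C. D (s c) ^ card H) = 0"
      using chevalley_warning_sum[OF deg] I less by (simp add: mult.commute)
    finally show False by simp
  qed
  moreover have "H \<subseteq> UNIV - {0}" "card (UNIV - {0::'a}) = CARD('a) - 1"
    using \<open>0 \<notin> H\<close> by (auto simp: card_Diff_subset)
  ultimately have "H = UNIV - {0}"
    by (intro card_seteq) auto
  then have "\<mu> \<in> H" using \<open>\<mu> \<noteq> 0\<close> by blast
  then show ?thesis by (auto simp: H_def D_def)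
qed

section \<open>Unitary centralizers\<close>

context reflexive_form
begin

text \<open>The product \<open>adj P ** P\<close> is nonzero exactly when \<beta> does not vanish
  identically on \<open>S\<close>. By irreducibility the radical of \<open>S\<close> is then zero,
  and \<open>E\<close> is the orthogonal projection onto \<open>S\<close>.\<close>

lemma exists_selfadjoint_projection:
  assumes X: "isometry X" and S: "irreducible_subspace X S"
    and P: "projection_onto P S" "commute X P" and nz: "adj P ** P \<noteq> 0"
  shows "\<exists>E. projection_onto E S \<and> commute X E \<and> adj E = E"
proof -
  have sub: "vec.subspace S" and X_in: "\<And>v. v \<in> S \<Longrightarrow> X *v v \<in> S"
    using S by (auto simp: irreducible_subspace_def invariant_subspace_def)
  have P_in: "P *v x \<in> S" and P_id: "x \<in> S \<Longrightarrow> P *v x = x" for x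
    using P(1) by (simp_all add: projection_onto_def)
  have Xadj: "X ** adj X = mat 1"
    using X isometry_iff' by blast
  obtain y where "adj P *v (P *v y) \<noteq> 0"
    using nz by (auto simp: matrix_eq matrix_vector_mul_assoc)
  then have ker: "v = 0" if "v \<in> S" "adj P *v v = 0" for v
    using irreducible_subspace_ker[OF S commute_adj_isometry[OF X P(2)] P_in _ that] by blast
  have "inj_on ((*v) (adj P)) S"
  proof (rule inj_onI)
    fix x y assume xy: "x \<in> S" "y \<in> S" "adj P *v x = adj P *v y"
    then have "x - y \<in> S" "adj P *v (x - y) = 0"
      using sub by (simp_all add: vec.subspace_diff mv_simps)
    then show "x = y" using ker by force
  qed
  from vec.linear_exists_left_inverse_on[OF matrix_vector_mul_linear_gen sub this]
  obtain g where g: "Vector_Spaces.linear (*s) (*s) g" "\<forall>v\<in>S. g (adj P *v v) = v"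
    by blast
  obtain G where G: "\<And>x. G *v x = g x"
    using matrix_works_ex[OF g(1)] by blast
  \<comment> \<open>The kernel of \<open>adj P\<close> is the orthogonal complement of
    \<open>S\<close>. The matrix \<open>G\<close> recovers a vector of \<open>S\<close> from its
    image under \<open>adj P\<close>, and the outer \<open>P\<close> keeps the values in
    \<open>S\<close>.\<close>
  define E where "E = P ** G ** adj P"
  have E_in: "E *v x \<in> S" for x
    by (simp add: E_def mv_simps P_in)
  have E_id: "E *v x = x" if "x \<in> S" for x
    using that g(2) by (simp add: E_def mv_simps G P_id)
  have "adj E = P ** adj G ** adj P"
    by (simp add: E_def adj_mult adj_adj matrix_mul_assoc)
  then have "adj E *v x \<in> S" for x
    by (simp add: mv_simps P_in)
  \<comment> \<open>As \<open>adj E\<close> also maps into \<open>S\<close>, where \<open>E\<close>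
    is the identity, \<open>adj E\<close> equals the selfadjoint product
    \<open>E ** adj E\<close>.\<close>
  then have EE: "E ** adj E = adj E"
    by (simp add: matrix_eq mv_simps E_id)
  moreover have "adj (E ** adj E) = E ** adj E"
    by (simp only: adj_mult adj_adj)
  ultimately have E_adj: "adj E = E"
    by (simp add: adj_adj)
  have "adj X *v v \<in> S" if "v \<in> S" for v
  proof -
    have "commute P (adj X)"
      using commute_inverse[OF commute_sym[OF P(2)] Xadj] .
    then have "P *v (adj X *v v) = adj X *v v"
      using commuteD[of P "adj X" v] P_id[OF that] by metis
    then show ?thesis using P_in by metis
  qed
  \<comment> \<open>Since \<open>S\<close> is invariant under \<open>X\<close> and its inverse
    \<open>adj X\<close>, both \<open>E ** X ** E = X ** E\<close> and, after taking adjoints,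
    \<open>E ** X ** E = E ** X\<close> hold.\<close>
  then have "E ** adj X ** E = adj X ** E"
    using E_in by (simp add: matrix_eq mv_simps E_id)
  then have "adj (E ** adj X ** E) = adj (adj X ** E)"
    by simp
  then have "E ** X ** E = E ** X"
    by (simp add: adj_mult adj_adj E_adj matrix_mul_assoc)
  moreover have "E ** X ** E = X ** E"
    using E_in X_in by (simp add: matrix_eq mv_simps E_id)
  ultimately have "commute X E"
    by (simp add: commute_def)
  then show ?thesis
    using E_in E_id E_adj by (auto simp: projection_onto_def)
qed

text \<open>The form pairs the image of \<open>adj P\<close> perfectly with \<open>U\<close>. For a
  Maschke projection \<open>e\<close> onto a nonzero submodule of that image, Schur's lemma makes
  \<open>adj e\<close> injective on \<open>U\<close>, which forces \<open>e\<close> to fix the whole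
  image.\<close>

lemma irreducible_subspace_adj:
  assumes X: "isometry X" and N: "mat_pow X N = mat 1" "of_nat N \<noteq> (0::'a)"
    and U: "irreducible_subspace X U" and P: "projection_onto P U" "commute X P"
  shows "irreducible_subspace X (range ((*v) (adj P)))"
  unfolding irreducible_subspace_def
proof (intro conjI allI impI)
  let ?T = "range ((*v) (adj P))"
  have P_in: "P *v x \<in> U" for x
    using P(1) by (simp add: projection_onto_def)
  have PP: "P ** P = P"
    using P(1) by (rule projection_onto_idem)
  then have "projection_onto (adj P) ?T"
    by (simp add: projection_onto_range flip: adj_mult)
  then have T_id: "adj P *v x = x" if "x \<in> ?T" for x
    using that unfolding projection_onto_def by blast
  show "invariant_subspace X ?T"
    using commute_adj_isometry[OF X P(2)] by (rule invariant_subspace_range)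
  show "?T \<noteq> {0}"
  proof
    assume "?T = {0}"
    then have "adj P = 0"
      by (auto simp: matrix_eq)
    then have "P = 0"
      by (metis adj_0 adj_adj)
    then have "U = {0}"
      using projection_onto_image[OF P(1)] by auto
    then show False
      using U by (simp add: irreducible_subspace_def)
  qed
  fix S assume S: "invariant_subspace X S \<and> S \<subseteq> ?T"
  show "S = {0} \<or> S = ?T"
  proof (cases "S = {0}")
    case False
    obtain e where e: "projection_onto e S" "commute X e"
      using maschke[OF conjunct1[OF S] N] by blast
    have "e *v x \<in> ?T" for x
      using e(1) S unfolding projection_onto_def by blast
    then have "adj P *v (e *v x) = e *v x" for x
      by (rule T_id)
    then have "adj P ** e = e"
      by (simp add: matrix_eq mv_simps)
    then have "adj (adj P ** e) = adj e" by simp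
    then have eP: "adj e ** P = adj e"
      by (simp add: adj_mult adj_adj)
    have ee: "adj e ** adj e = adj e"
      using projection_onto_idem[OF e(1)] by (simp flip: adj_mult)
    have "adj e \<noteq> 0"
    proof
      assume "adj e = 0"
      then have "e = 0" by (metis adj_0 adj_adj)
      then show False
        using False projection_onto_image[OF e(1)] by auto
    qed
    then obtain y where "adj e *v (P *v y) \<noteq> 0"
      using eP by (auto simp: matrix_eq matrix_vector_mul_assoc)
    then have ker: "v = 0" if "v \<in> U" "adj e *v v = 0" for v
      using irreducible_subspace_ker[OF U commute_adj_isometry[OF X e(2)] P_in _ that] by blast
    \<comment> \<open>This vector lies in \<open>U\<close> and is killed by \<open>adj e\<close>,
      because \<open>adj e\<close> absorbs \<open>P\<close> and is idempotent.\<close>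
    have "P *v (adj e *v x - x) = 0" for x
    proof (rule ker[OF P_in])
      have "adj e *v (P *v (adj e *v x - x)) = (adj e ** P) *v (adj e *v x - x)"
        by (simp only: matrix_vector_mul_assoc)
      also have "\<dots> = (adj e ** adj e) *v x - adj e *v x"
        unfolding eP by (simp add: mv_simps)
      finally show "adj e *v (P *v (adj e *v x - x)) = 0"
        by (simp add: ee)
    qed
    then have "P ** adj e = P"
      by (simp add: matrix_eq mv_simps)
    then have "adj (P ** adj e) = adj P" by simp
    then have "e ** adj P = adj P"
      by (simp add: adj_mult adj_adj)
    then have "adj P *v x \<in> S" for x
      using e(1) by (metis matrix_vector_mul_assoc projection_onto_def)
    then show ?thesis
      using S by blast
  qed simp
qed

text \<open>If \<beta> is nonzero on the image of \<open>P\<close> or of \<open>adj P\<close>, that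
  image carries a selfadjoint projection. If both images are totally isotropic, the two products of
  \<open>P\<close> and \<open>adj P\<close> vanish and hence agree.\<close>

lemma exists_normal_projection:
  assumes X: "isometry X" and N: "mat_pow X N = mat 1" "of_nat N \<noteq> (0::'a)"
    and U: "irreducible_subspace X U"
  shows "\<exists>P U. irreducible_subspace X U \<and> projection_onto P U \<and> commute X P \<and> commute P (adj P)"
proof -
  obtain P where P: "projection_onto P U" "commute X P"
    using maschke U N by (metis irreducible_subspace_def)
  let ?T = "range ((*v) (adj P))"
  have T: "irreducible_subspace X ?T"
    using irreducible_subspace_adj[OF X N U P] .
  have PP: "adj P ** adj P = adj P"
    using projection_onto_idem[OF P(1)] by (simp flip: adj_mult)
  consider "adj P ** P \<noteq> 0" | "P ** adj P \<noteq> 0" | "adj P ** P = 0" "P ** adj P = 0"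
    by blast
  then show ?thesis
  proof cases
    case 1
    then show ?thesis
      using exists_selfadjoint_projection[OF X U P] U commute_refl by metis
  next
    case 2
    have "projection_onto (adj P) ?T"
      using PP by (simp add: projection_onto_range)
    then show ?thesis
      using exists_selfadjoint_projection[OF X T _ commute_adj_isometry[OF X P(2)]] 2 T commute_refl
      by (metis adj_adj)
  next
    case 3
    then have "commute P (adj P)"
      by (simp add: commute_def)
    then show ?thesis
      using U P by blast
  qed
qed

end

text \<open>The equation says \<open>det W = \<mu> / \<sigma> \<mu>\<close>, the shape that Hilbert
  90 gives to elements of norm one.\<close>

theorem exists_commuting_isometry_det:
  fixes \<sigma> :: "'a::{field,finite} \<Rightarrow> 'a" and \<beta> :: "'a ^ 'n \<Rightarrow> 'a ^ 'n \<Rightarrow> 'a"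
  assumes "reflexive_form \<sigma> \<epsilon> \<beta>"
    and X: "reflexive_form.isometry \<beta> X" and N: "mat_pow X N = mat 1" "of_nat N \<noteq> (0::'a)" and "\<mu> \<noteq> 0"
  shows "\<exists>W. reflexive_form.isometry \<beta> W \<and> commute X W \<and> det W * \<sigma> \<mu> = \<mu>"
proof -
  interpret reflexive_form \<sigma> \<epsilon> \<beta> by fact
  obtain U0 where "irreducible_subspace X U0"
    using exists_irreducible_subspace by blast
  then obtain P U where U: "irreducible_subspace X U" and P: "projection_onto P U" "commute X P"
    "commute P (adj P)"
    using exists_normal_projection[OF X N] by blast
  obtain a where a: "bicommutant X a" "det (mat 1 - P + a ** P) = \<mu>"
    using exists_bicommutant_det[OF U P(1,2) \<open>\<mu> \<noteq> 0\<close>] by blast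
  define r where "r = mat 1 - P + a ** P"
  have aP: "commute a P" and aP': "commute a (adj P)"
    using a(1) P(2) commute_adj_isometry[OF X] by (auto simp: bicommutant_def)
  have aa': "commute a (adj a)"
    using a(1) bicommutant_commute commute_adj_isometry[OF X] unfolding bicommutant_def by blast
  have Pa': "commute P (adj a)"
    using adj_commute[OF aP'] by (simp add: adj_adj commute_sym)
  have r_adj: "adj r = mat 1 - adj P + adj P ** adj a"
    by (simp add: r_def adj_add adj_diff adj_1 adj_mult)
  \<comment> \<open>Both \<open>adj P\<close> and \<open>adj a\<close> commute with
    \<open>X\<close>, hence with \<open>a\<close>. They commute with \<open>P\<close> by the choice
    of \<open>P\<close> and by taking adjoints.\<close>
  have "commute a (adj r)" "commute P (adj r)"
    unfolding r_adj by (intro commute_intros aP' aa' P(3) Pa')+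
  then have "commute (adj r) a" "commute (adj r) P"
    by (simp_all add: commute_def)
  then have normal: "commute (adj r) r"
    by (subst (2) r_def) (intro commute_intros)
  have Xr: "commute X r"
    unfolding r_def using P(2) bicommutant_commute[OF a(1)] by (intro commute_intros)
  have "det (adj r) \<noteq> 0"
    using \<open>\<mu> \<noteq> 0\<close> a(2) \<sigma>_0 \<sigma>_invol unfolding det_adj r_def by metis
  then have "invertible (adj r)"
    by (simp add: invertible_det_nz)
  then obtain s where s: "adj r ** s = mat 1" "s ** adj r = mat 1"
    by (auto simp: invertible_def)
  define W where "W = r ** s"
  have "adj s ** r = mat 1"
    using arg_cong[OF s(1), of adj] by (simp add: adj_mult adj_adj adj_1)
  have sr: "commute s r"
    using commute_inverse[OF commute_sym[OF normal] s(1)] by (rule commute_sym)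
  have "adj W ** W = adj s ** (adj r ** r) ** s"
    by (simp add: W_def adj_mult matrix_mul_assoc)
  also have "\<dots> = (adj s ** r) ** (adj r ** s)"
    using normal by (simp add: commute_def matrix_mul_assoc)
  finally have "isometry W"
    using \<open>adj s ** r = mat 1\<close> s(1) by (simp add: isometry_iff)
  moreover have "commute X W"
    unfolding W_def
    by (intro commute_mult Xr commute_inverse[OF commute_adj_isometry[OF X Xr] s(1)])
  moreover have "det W * \<sigma> \<mu> = \<mu>"
  proof -
    have "W ** adj r = r"
      using s(2) by (simp add: W_def flip: matrix_mul_assoc)
    then have "det W * det (adj r) = det r"
      by (metis det_mul)
    then show ?thesis
      using a(2) by (simp add: det_adj r_def)
  qed
  ultimately show ?thesis by blast
qed

section \<open>Alternating and symmetric forms\<close>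

text \<open>Induction on the number of vectors that \<open>W\<close> negates. If only zero is
  negated, comparing \<open>1 + W\<close> with its adjoint gives the determinant; otherwise
  composition with a transvection shrinks the space of negated vectors.\<close>

theorem alternating_isometry_det:
  fixes \<beta> :: "'a::{field,finite} ^ 'n \<Rightarrow> 'a ^ 'n \<Rightarrow> 'a"
  assumes form: "reflexive_form (\<lambda>x. x) (- 1) \<beta>" and two: "(2::'a) \<noteq> 0"
    and "reflexive_form.isometry \<beta> W"
  shows "det W = 1"
  using assms(3)
proof (induction "card {u. W *v u + u = 0}" arbitrary: W rule: less_induct)
  case less
  interpret reflexive_form "\<lambda>x. x" "- 1" \<beta> by fact
  have alt: "\<beta> v v = 0" for v
    using swap[of v v] two by (simp add: eq_neg_iff_add_eq_0 flip: mult_2)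
  have det_1: "det V = 1" if V: "isometry V" "\<And>u. V *v u + u = 0 \<Longrightarrow> u = 0" for V
  proof -
    \<comment> \<open>From \<open>V ** adj V = mat 1\<close>. Since \<sigma> is the identity,
      \<open>1 + V\<close> and its adjoint have the same determinant, which cancels when
      \<open>- 1\<close> is not an eigenvalue of \<open>V\<close>.\<close>
    have "mat 1 + V = V ** (adj V + mat 1)"
      using V(1) by (simp add: isometry_iff' matrix_add_ldistrib)
    also have "adj V + mat 1 = adj (mat 1 + V)"
      by (simp add: adj_add adj_1 add.commute)
    finally have eq: "mat 1 + V = V ** adj (mat 1 + V)" .
    have "det (mat 1 + V) = det V * det (mat 1 + V)"
    proof -
      have "det (mat 1 + V) = det (V ** adj (mat 1 + V))"
        using eq by (rule arg_cong)
      also have "\<dots> = det V * det (adj (mat 1 + V))"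
        by (rule det_mul)
      also have "\<dots> = det V * det (mat 1 + V)"
        by (subst det_adj) (rule refl)
      finally show ?thesis .
    qed
    moreover have "det (mat 1 + V) \<noteq> 0"
      unfolding det_nz_iff_ker by (intro allI impI, rule V(2)) (simp add: mv_simps add.commute)
    ultimately show ?thesis by simp
  qed
  show ?case
  proof (cases "\<forall>u. W *v u + u = 0 \<longrightarrow> u = 0")
    case True
    then show ?thesis using det_1 less.prems by blast
  next
    case False
    then obtain u0 where u0: "W *v u0 + u0 = 0" "u0 \<noteq> 0" by blast
    obtain v where v: "\<beta> u0 v \<noteq> 0"
      using nondeg u0(2) by blast
    have W: "\<beta> (W *v x) (W *v y) = \<beta> x y" for x y
      using less.prems by (simp add: isometry_def)
    \<comment> \<open>The transvection along \<open>v\<close>, a vector that is not orthogonal to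
      the negated vector \<open>u0\<close>.\<close>
    have "Vector_Spaces.linear (*s) (*s) (\<lambda>x. x + \<beta> x v *s v)"
      by unfold_locales (simp_all add: add_left scale_left vec.scale_right_distrib vec.scale_left_distrib)
    then obtain T where T: "\<And>x. T *v x = x + \<beta> x v *s v"
      using matrix_works_ex by blast
    have anti: "\<beta> v x = - \<beta> x v" for x
      by (subst swap) simp
    have T_iso: "isometry T"
      by (simp add: isometry_def T add_left add_right scale_left scale_right alt anti)
    have "det T = 1"
    proof (rule det_1[OF T_iso])
      fix u assume "T *v u + u = 0"
      then have eq: "u + u + \<beta> u v *s v = 0"
        by (simp add: T algebra_simps)
      then have "\<beta> (u + u + \<beta> u v *s v) v = 0"
        by (simp add: zero_left)
      then have "2 * \<beta> u v = 0"
        by (simp only: add_left scale_left alt mult_2 mult_zero_right add_0_right)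
      then have "u + u = 0"
        using eq two by simp
      then have "2 * u $ i = 0" for i
        by (simp only: mult_2 flip: vector_add_component) simp
      then show "u = 0"
        using two by (simp add: vec_eq_iff)
    qed
    \<comment> \<open>Pairing the equation with \<open>u0\<close>, which \<open>W\<close> negates,
      leaves \<open>\<beta> u v * \<beta> u0 v = 0\<close> up to sign. So \<open>T\<close> fixes
      \<open>u\<close>, while \<open>u0\<close> drops out of the space.\<close>
    have sub: "W *v u + u = 0 \<and> \<beta> u v = 0" if "(W ** T) *v u + u = 0" for u
    proof -
      have eq: "W *v u + \<beta> u v *s (W *v v) + u = 0"
        using that by (simp add: mv_simps T vec.scale)
      then have "\<beta> u0 (W *v u + \<beta> u v *s (W *v v) + u) = 0"
        by (simp add: zero_right)
      moreover have "\<beta> u0 (W *v x) = - \<beta> u0 x" for x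
      proof -
        have "W *v u0 = - u0"
          using u0(1) by (simp add: eq_neg_iff_add_eq_0)
        then have "\<beta> (0 - u0) (W *v x) = \<beta> u0 x"
          using W[of u0 x] by simp
        then show ?thesis
          unfolding diff_left zero_left by (metis diff_0 minus_minus)
      qed
      ultimately have "\<beta> u v = 0"
        using v by (simp add: add_right scale_right)
      then show ?thesis using eq by simp
    qed
    then have "{u. (W ** T) *v u + u = 0} \<subset> {u. W *v u + u = 0}"
      using u0 v by blast
    then have "card {u. (W ** T) *v u + u = 0} < card {u. W *v u + u = 0}"
      by (intro psubset_card_mono) auto
    then have "det (W ** T) = 1"
      using less.hyps isometry_mult less.prems T_iso by blast
    then show ?thesis
      using \<open>det T = 1\<close> by (simp add: det_mul)
  qed
qed

text \<open>The reflection in \<open>v\<close>: the rank one formula gives its determinant as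
  \<open>1 - 2\<close>.\<close>

lemma (in reflexive_form) exists_reflection:
  assumes id: "\<And>x. \<sigma> x = x" "\<epsilon> = 1" and v: "\<beta> v v \<noteq> 0"
  shows "\<exists>s. isometry s \<and> det s = - 1 \<and> (\<forall>u. s *v u = u - (2 * \<beta> u v / \<beta> v v) *s v)"
proof -
  have "Vector_Spaces.linear (*s) (*s) (\<lambda>u. u - (2 * \<beta> u v / \<beta> v v) *s v)"
    by unfold_locales
      (simp_all add: add_left scale_left vec_eq_iff add_divide_distrib algebra_simps)
  then obtain s where s: "\<And>u. s *v u = u - (2 * \<beta> u v / \<beta> v v) *s v"
    using matrix_works_ex by blast
  have sym: "\<beta> v u = \<beta> u v" for u
    by (subst swap) (simp add: id)
  have "\<beta> (s *v x) (s *v y) = \<beta> x y" for x y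
  proof -
    define t r where "t = \<beta> x v / \<beta> v v" and "r = \<beta> y v / \<beta> v v"
    have "\<beta> x v = t * \<beta> v v" "\<beta> v y = r * \<beta> v v"
      using v sym[of y] by (simp_all add: t_def r_def)
    moreover have "s *v x = x - (2 * t) *s v" "s *v y = y - (2 * r) *s v"
      by (simp_all add: s t_def r_def)
    ultimately show ?thesis
      by (simp only: diff_left diff_right scale_left scale_right id) (simp add: algebra_simps)
  qed
  then have "isometry s"
    by (simp add: isometry_def)
  moreover have "det s = 1 + - (2 * \<beta> v v / \<beta> v v)"
    using v zero_left by (intro det_rank_one_perturbation[of s "\<lambda>u. - (2 * \<beta> u v / \<beta> v v)" v]) (auto simp: s)
  ultimately show ?thesis
    using s v by (intro exI[of _ s]) simp
qed

lemma (in reflexive_form) polarize: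
  assumes id: "\<And>x. \<sigma> x = x" "\<epsilon> = 1" and two: "(2::'a) \<noteq> 0"
    and "\<beta> u u = 0" "\<beta> v v = 0" "\<beta> (u + v) (u + v) = 0"
  shows "\<beta> u v = 0"
proof -
  have "\<beta> v u = \<beta> u v"
    by (subst swap) (simp add: id)
  then show ?thesis
    using assms by (simp add: add_left add_right flip: mult_2)
qed

text \<open>Otherwise the fixed space is totally isotropic by polarization. For every
  \<open>x\<close> the sum \<open>a\<close> of its translates under the powers of \<open>Y\<close>
  is fixed, so \<open>0 = \<beta> k a = M * \<beta> k x\<close>, and \<open>k\<close> would lie in
  the radical.\<close>

lemma (in reflexive_form) exists_fixed_nonisotropic:
  assumes id: "\<And>x. \<sigma> x = x" "\<epsilon> = 1" and two: "(2::'a) \<noteq> 0"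
    and Y: "isometry Y" and M: "mat_pow Y M = mat 1" "of_nat M \<noteq> (0::'a)"
    and k: "Y *v k = k" "k \<noteq> 0"
  shows "\<exists>v. Y *v v = v \<and> \<beta> v v \<noteq> 0"
proof (rule ccontr)
  assume "\<not> ?thesis"
  then have iso: "\<beta> v v = 0" if "Y *v v = v" for v
    using that by blast
  have "\<beta> k x = 0" for x
  proof -
    define a where "a = (\<Sum>i<M. mat_pow Y i *v x)"
    have "Y *v a = (\<Sum>i<M. mat_pow Y (Suc i) *v x)"
      by (simp add: a_def vec.sum matrix_vector_mul_assoc)
    also have "\<dots> = a"
      using sum.lessThan_Suc_shift[of "\<lambda>i. mat_pow Y i *v x" M]
        sum.lessThan_Suc[of "\<lambda>i. mat_pow Y i *v x" M] M(1)
      by (simp add: a_def add.commute)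
    finally have a: "Y *v a = a" .
    have "\<beta> k a = 0"
      by (rule polarize[OF id two iso[OF k(1)] iso[OF a] iso]) (simp add: mv_simps a k(1))
    moreover have "\<beta> k (mat_pow Y i *v x) = \<beta> k x" for i
    proof (induction i)
      case (Suc i)
      have "\<beta> (Y *v k) (Y *v (mat_pow Y i *v x)) = \<beta> k (mat_pow Y i *v x)"
        using Y by (simp add: isometry_def)
      then show ?case
        using Suc k(1) by (simp add: matrix_vector_mul_assoc)
    qed simp
    ultimately have "of_nat M * \<beta> k x = 0"
      by (simp add: a_def sum_right)
    then show ?thesis using M(2) by simp
  qed
  then show False using nondeg k(2) by blast
qed

lemma mat_pow_scale: "mat_pow (mat c ** X) i *v x = c ^ i *s (mat_pow X i *v x)" for X :: "'a::field ^ 'n ^ 'n"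
  by (induction i) (simp_all add: mv_simps mat_mult_vec vec.scale)

lemma (in reflexive_form) exists_commuting_reflection:
  assumes id: "\<And>x. \<sigma> x = x" "\<epsilon> = 1" and two: "(2::'a) \<noteq> 0"
    and X: "isometry X" and N: "mat_pow X N = mat 1" "of_nat N \<noteq> (0::'a)"
    and sing: "\<not> invertible (X ** X - mat 1)"
  shows "\<exists>s. isometry s \<and> det s = - 1 \<and> commute X s"
proof -
  obtain v where v: "v \<noteq> 0" "X *v (X *v v) = v"
    using sing by (auto simp: invertible_iff_ker mv_simps)
  \<comment> \<open>Either \<open>X\<close> negates \<open>v\<close>, or \<open>X *v v + v\<close>
    is a nonzero vector fixed by \<open>X\<close>.\<close>
  have "\<exists>e k. e * e = 1 \<and> X *v k = e *s k \<and> k \<noteq> 0"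
  proof (cases "X *v v + v = 0")
    case True
    then have "X *v v = (- 1) *s v"
      by (simp add: eq_neg_iff_add_eq_0)
    then show ?thesis using v(1) by (intro exI[of _ "- 1"] exI[of _ v]) simp
  next
    case False
    then show ?thesis
      using v(2) by (intro exI[of _ 1] exI[of _ "X *v v + v"]) (simp add: mv_simps add.commute)
  qed
  then obtain e k where e: "e * e = 1" and k: "X *v k = e *s k" "k \<noteq> 0" by blast
  \<comment> \<open>Scaling by \<open>e\<close> turns the eigenvectors of \<open>X\<close> for
    \<open>e\<close> into fixed vectors.\<close>
  define Y where "Y = mat e ** X"
  have Y: "Y *v x = e *s (X *v x)" for x
    by (simp add: Y_def mv_simps mat_mult_vec)
  have e2: "e * (e * t) = t" for t
    by (simp add: e flip: mult.assoc)
  have "isometry Y"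
    using X by (simp add: isometry_def Y scale_left scale_right id e2)
  \<comment> \<open>The exponent is doubled because \<open>e\<close> may be \<open>- 1\<close> and
    \<open>N\<close> odd.\<close>
  moreover have "mat_pow Y (2 * N) = mat 1"
  proof -
    have "mat_pow X (2 * N) = mat 1"
      using N(1) by (simp add: mult_2 mat_pow_add)
    moreover have "e ^ (2 * N) = 1"
      by (simp add: power_mult power2_eq_square e)
    ultimately show ?thesis
      by (simp add: matrix_eq Y_def mat_pow_scale)
  qed
  moreover have "of_nat (2 * N) \<noteq> (0::'a)"
    using two N(2) by simp
  moreover have "Y *v k = k"
    by (simp add: Y k e)
  ultimately obtain w where w: "Y *v w = w" "\<beta> w w \<noteq> 0"
    using exists_fixed_nonisotropic[OF id two] k(2) by blast
  have Xw: "X *v w = e *s w"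
    using arg_cong[OF w(1), of "\<lambda>x. e *s x"] by (simp add: Y e)
  obtain s where s: "isometry s" "det s = - 1" "\<And>u. s *v u = u - (2 * \<beta> u w / \<beta> w w) *s w"
    using exists_reflection[OF id w(2)] by blast
  have Xu: "\<beta> (X *v u) w = e * \<beta> u w" for u
  proof -
    have "\<beta> (X *v u) w = \<beta> (X *v u) (e *s (X *v w))"
      using w(1) by (simp add: Y)
    then show ?thesis
      using X by (simp add: isometry_def scale_right id)
  qed
  have "commute X s"
    by (simp add: commute_def matrix_eq mv_simps s(3) Xu Xw vec.scale mult_ac)
  then show ?thesis using s by blast
qed

lemma (in reflexive_form) exists_isometry_det_minus_1:
  assumes id: "\<And>x. \<sigma> x = x" "\<epsilon> = 1" and two: "(2::'a) \<noteq> 0"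
  shows "\<exists>s. isometry s \<and> det s = - 1"
proof -
  have "\<exists>v. \<beta> v v \<noteq> 0"
  proof (rule ccontr)
    assume "\<not> ?thesis"
    \<comment> \<open>The all-ones vector stands for an arbitrary nonzero vector; polarization would
      put it into the radical.\<close>
    then have "\<beta> 1 v = 0" for v
      using polarize[OF id two] by blast
    then have "(1 :: 'a^'n) = 0" by (rule nondeg)
    then show False by (simp add: vec_eq_iff)
  qed
  then show ?thesis
    using exists_reflection[OF id] by blast
qed

lemma commuting_isometry_det:
  fixes \<beta> :: "'a::{field,finite} ^ 'n \<Rightarrow> 'a ^ 'n \<Rightarrow> 'a"
  assumes form: "reflexive_form (\<lambda>x. x) 1 \<beta>" and two: "(2::'a) \<noteq> 0"
    and X: "reflexive_form.isometry \<beta> X" and inv: "invertible (X ** X - mat 1)"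
    and W: "reflexive_form.isometry \<beta> W" "commute X W"
  shows "det W = 1"
proof -
  interpret reflexive_form "\<lambda>x. x" 1 \<beta> by fact
  \<comment> \<open>As \<open>adj X\<close> is the inverse of \<open>X\<close>, the matrix
    \<open>S\<close> is skew with respect to \<open>adj\<close>, and its kernel consists of the
    vectors fixed by \<open>X ** X\<close>.\<close>
  define S where "S = X - adj X"
  define \<omega> where "\<omega> u v = \<beta> (S *v u) v" for u v
  have sym: "\<beta> u v = \<beta> v u" for u v
    by (subst swap) simp
  have "adj S = - S"
    by (simp add: S_def adj_diff adj_adj)
  have anti: "\<omega> v u = - \<omega> u v" for u v
  proof -
    have "\<omega> v u = \<beta> v (adj S *v u)"
      by (simp add: \<omega>_def adj)
    also have "adj S *v u = 0 - S *v u"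
      unfolding \<open>adj S = - S\<close> by (metis diff_0 matrix_vector_mult_0 matrix_vector_mult_diff_rdistrib)
    also have "\<beta> v (0 - S *v u) = - \<beta> v (S *v u)"
      using diff_right[of v 0 "S *v u"] zero_right[of v] by simp
    finally show ?thesis
      unfolding \<omega>_def sym[of v "S *v u"] .
  qed
  have \<omega>_nondeg: "u = 0" if "\<And>v. \<omega> u v = 0" for u
  proof -
    have "S *v u = 0"
      using that nondeg by (simp add: \<omega>_def)
    then have "X *v (X *v u) = X *v (adj X *v u)"
      by (simp add: S_def mv_simps)
    also have "\<dots> = u"
      using X isometry_iff'[of X] by (simp add: matrix_vector_mul_assoc)
    finally have "(X ** X - mat 1) *v u = 0"
      by (simp add: mv_simps)
    then show ?thesis
      using inv invertible_iff_ker by blast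
  qed
  have \<omega>: "reflexive_form (\<lambda>x. x) (- 1) \<omega>"
  proof unfold_locales
    fix u u' v c
    show "\<omega> (u + u') v = \<omega> u v + \<omega> u' v"
      by (simp add: \<omega>_def mv_simps add_left)
    show "\<omega> (c *s u) v = c * \<omega> u v"
      by (simp add: \<omega>_def vec.scale scale_left)
    show "\<omega> v u = - 1 * \<omega> u v"
      using anti[of v u] by simp
    show "u = 0" if "\<And>v. \<omega> u v = 0"
      using that by (rule \<omega>_nondeg)
  qed simp_all
  have "commute W S"
    unfolding S_def using commute_adj_isometry[OF W(1)] W(2) commute_inverse[of W X "adj X"] X isometry_iff'
    by (intro commute_diff) (auto simp: commute_sym)
  then have "reflexive_form.isometry \<omega> W"
    using W(1) unfolding reflexive_form.isometry_def[OF \<omega>] isometry_def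
    by (simp add: \<omega>_def flip: commuteD[of W S])
  then show ?thesis
    using alternating_isometry_det[OF \<omega> two] by blast
qed

section \<open>Hilbert 90\<close>

lemma power_card_field:
  fixes x :: "'a::{field,finite}"
  shows "x ^ CARD('a) = x"
proof (cases "x = 0")
  case False
  have "x ^ card (UNIV - {0::'a}) = 1"
    using False by (intro finite_mult_closed_power_card) auto
  then have "x ^ (CARD('a) - 1) = 1"
    by (simp add: card_Diff_subset)
  moreover have "CARD('a) = Suc (CARD('a) - 1)"
    by simp
  ultimately show ?thesis
    by (metis mult.right_neutral power_Suc)
qed simp

text \<open>The characteristic divides \<open>q\<^sup>2\<close>, so \<open>q\<close> is a power of
  it and \<open>x ^ q\<close> is an iterate of the Frobenius map.\<close>

lemma power_add_field:
  fixes x y :: "'a::{field,finite}"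
  assumes "primepow q" "CARD('a) = q\<^sup>2"
  shows "(x + y) ^ q = x ^ q + y ^ q"
proof -
  obtain p k where p: "prime p" "q = p ^ k"
    using assms(1) by (auto simp: primepow_def)
  have prime: "prime CHAR('a)"
    by (simp add: finite_imp_CHAR_pos prime_CHAR_semidom)
  have "CHAR('a) dvd (p ^ k)\<^sup>2"
    using CHAR_dvd_CARD[where 'a = 'a] assms(2) p(2) by simp
  then have "CHAR('a) dvd p"
    using prime prime_dvd_power by blast
  then have "CHAR('a) = p"
    using prime p(1) primes_dvd_imp_eq by blast
  then show ?thesis
    using freshmans_dream'[OF prime, of q k] p(2) by blast
qed

text \<open>The resolvent \<open>x + l * x ^ q\<close> satisfies the equation for every
  \<open>x\<close>. As a nonzero polynomial in \<open>x\<close> of degree at most \<open>q\<close>,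
  it cannot vanish on all \<open>q\<^sup>2\<close> elements.\<close>

lemma hilbert_90:
  fixes l :: "'a::{field,finite}"
  assumes q: "primepow q" "CARD('a) = q\<^sup>2" and l: "l * l ^ q = 1"
  shows "\<exists>\<mu>. \<mu> \<noteq> 0 \<and> l * \<mu> ^ q = \<mu>"
proof -
  have "1 < q"
    using q(1) primepow_gt_Suc_0 by force
  define p where "p = monom l q + monom 1 1"
  have "degree p \<le> q"
    unfolding p_def using \<open>1 < q\<close>
    by (intro degree_add_le) (auto intro: order.trans[OF degree_monom_le])
  moreover have "coeff p 1 = 1"
    using \<open>1 < q\<close> by (simp add: p_def)
  then have "p \<noteq> 0" by auto
  then have "card {x. poly p x = 0} \<le> degree p"
    by (rule card_poly_roots_bound)
  moreover have "q < q\<^sup>2"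
    using \<open>1 < q\<close> by (simp add: power2_eq_square)
  ultimately have "{x. poly p x = 0} \<noteq> UNIV"
    using q(2) by (metis le_trans not_le)
  then obtain x where x: "poly p x \<noteq> 0" by blast
  define \<mu> where "\<mu> = x + l * x ^ q"
  have "\<mu> ^ q = x ^ q + l ^ q * (x ^ q) ^ q"
    unfolding \<mu>_def by (simp add: power_add_field[OF q] power_mult_distrib)
  also have "(x ^ q) ^ q = x"
    using power_card_field[of x] q(2) by (simp add: power2_eq_square power_mult)
  finally have "l * \<mu> ^ q = l * x ^ q + (l * l ^ q) * x"
    by (simp add: algebra_simps)
  then have "l * \<mu> ^ q = \<mu>"
    by (simp add: l \<mu>_def)
  moreover have "\<mu> \<noteq> 0"
    using x by (simp add: p_def \<mu>_def poly_monom add.commute)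
  ultimately show ?thesis by blast
qed

section \<open>Hermitian and quadratic forms as reflexive forms\<close>

lemma two_neq_0_field:
  assumes "odd CARD('a::{field,finite})"
  shows "(2::'a) \<noteq> 0"
proof
  assume "(2::'a) = 0"
  then have "CHAR('a) dvd 2"
    using of_nat_eq_0_iff_char_dvd[of 2, where 'a = 'a] by simp
  then have "CHAR('a) = 2"
    using CHAR_not_1[where 'a = 'a] by (metis One_nat_def primes_dvd_imp_eq two_is_prime_nat prime_nat_iff)
  then show False
    using CHAR_dvd_CARD[where 'a = 'a] assms by simp
qed

lemma hermitian_reflexive_form:
  fixes \<beta> :: "'a::{field,finite} ^ 'n \<Rightarrow> 'a ^ 'n \<Rightarrow> 'a"
  assumes q: "primepow q" "CARD('a) = q\<^sup>2" and \<beta>: "hermitian_form q \<beta>" "nondegenerate_form \<beta>"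
  shows "reflexive_form (\<lambda>x. x ^ q) 1 \<beta>"
proof unfold_locales
  fix u u' v :: "'a ^ 'n" and c x y :: 'a
  interpret L: Vector_Spaces.linear "(*s)" "(*)" "\<lambda>u. \<beta> u v"
    using \<beta>(1) unfolding hermitian_form_def by blast
  show "\<beta> (u + u') v = \<beta> u v + \<beta> u' v"
    by (rule L.add)
  show "\<beta> (c *s u) v = c * \<beta> u v"
    by (rule L.scale)
  show "\<beta> v u = 1 * \<beta> u v ^ q"
    using \<beta>(1) unfolding hermitian_form_def mult_1 by blast
  show "u = 0" if "\<And>v. \<beta> u v = 0"
    using \<beta>(2) that unfolding nondegenerate_form_def by blast
  show "(x + y) ^ q = x ^ q + y ^ q"
    by (rule power_add_field[OF q])
  show "(x ^ q) ^ q = x"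
    using power_card_field[of x] q(2) by (simp add: power2_eq_square power_mult)
qed (simp_all add: power_mult_distrib)

lemma polar_form_self: "quadratic_form Q \<Longrightarrow> polar_form Q v v = 2 * Q v"
proof -
  assume "quadratic_form Q"
  then have "Q ((2::'a) *s v) = 2\<^sup>2 * Q v"
    unfolding quadratic_form_def by blast
  moreover have "(2::'a) *s v = v + v"
    by (simp add: vec_eq_iff)
  ultimately show ?thesis
    by (simp add: polar_form_def power2_eq_square)
qed

lemma polar_reflexive_form:
  fixes Q :: "'a::field ^ 'n \<Rightarrow> 'a"
  assumes Q: "nonsingular_quadratic_form Q" and two: "(2::'a) \<noteq> 0"
  shows "reflexive_form (\<lambda>x. x) 1 (polar_form Q)"
proof unfold_locales
  fix u u' v :: "'a ^ 'n" and c :: 'a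
  have quad: "quadratic_form Q"
    using Q by (simp add: nonsingular_quadratic_form_def)
  interpret L: Vector_Spaces.linear "(*s)" "(*)" "\<lambda>u. polar_form Q u v"
    using quad unfolding quadratic_form_def by blast
  show "polar_form Q (u + u') v = polar_form Q u v + polar_form Q u' v"
    by (rule L.add)
  show "polar_form Q (c *s u) v = c * polar_form Q u v"
    by (rule L.scale)
  show "polar_form Q v u = 1 * polar_form Q u v"
    by (simp add: polar_form_def add.commute)
  \<comment> \<open>For \<open>u\<close> in the radical of the polar form,
    \<open>2 * Q u = polar_form Q u u = 0\<close>, so \<open>u\<close> is singular as well.\<close>
  show "u = 0" if "\<And>v. polar_form Q u v = 0"
    using Q that polar_form_self[OF quad, of u] two unfolding nonsingular_quadratic_form_def by simp
qed simp_all

text \<open>The quadratic form is recovered from its polar form by halving the values on the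
  diagonal.\<close>

lemma polar_isometry_iff:
  fixes Q :: "'a::field ^ 'n \<Rightarrow> 'a"
  assumes Q: "nonsingular_quadratic_form Q" and two: "(2::'a) \<noteq> 0"
  shows "reflexive_form.isometry (polar_form Q) A \<longleftrightarrow> (\<forall>v. Q (A *v v) = Q v)"
proof -
  interpret reflexive_form "\<lambda>x. x" 1 "polar_form Q"
    using polar_reflexive_form[OF assms] .
  have self: "polar_form Q v v = 2 * Q v" for v
    using Q polar_form_self by (auto simp: nonsingular_quadratic_form_def)
  show ?thesis
  proof
    assume "isometry A"
    then have "2 * Q (A *v v) = 2 * Q v" for v
      unfolding isometry_def by (metis self)
    then show "\<forall>v. Q (A *v v) = Q v"
      using two by simp
  next
    assume "\<forall>v. Q (A *v v) = Q v"
    then show "isometry A"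
      by (simp add: isometry_def polar_form_def flip: matrix_vector_right_distrib)
  qed
qed

section \<open>Classes in the special subgroup\<close>

text \<open>Covers the full isometry groups and their special subgroups alike.\<close>

locale matrix_group =
  fixes G :: "('a::field ^ 'n ^ 'n) monoid"
  assumes mult: "mult G = (**)" and one: "one G = mat 1"
    and mat_1_closed: "mat 1 \<in> carrier G"
    and matrix_mult_closed: "A \<in> carrier G \<Longrightarrow> B \<in> carrier G \<Longrightarrow> A ** B \<in> carrier G"
    and matrix_inverse_closed: "A \<in> carrier G \<Longrightarrow> \<exists>B\<in>carrier G. B ** A = mat 1"
begin

sublocale group G
  by (rule groupI) (auto simp: mult one mat_1_closed matrix_mult_closed matrix_inverse_closed matrix_mul_assoc)

text \<open>The group inverse depends on the record \<open>G\<close>; the equation on the right does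
  not, which makes conjugacy in a group and in its special subgroup comparable.\<close>

lemma conjugate_by_iff:
  assumes "Z \<in> carrier G"
  shows "Y = conjugate_by G X Z \<longleftrightarrow> Z ** Y = X ** Z"
proof -
  have inv: "Z ** inv\<^bsub>G\<^esub> Z = mat 1" "inv\<^bsub>G\<^esub> Z ** Z = mat 1"
    using r_inv[OF assms] l_inv[OF assms] by (simp_all add: mult one)
  show ?thesis
  proof
    assume "Y = conjugate_by G X Z"
    then have "Z ** Y = (Z ** inv\<^bsub>G\<^esub> Z) ** X ** Z"
      by (simp add: conjugate_by_def mult matrix_mul_assoc)
    then show "Z ** Y = X ** Z"
      by (simp add: inv)
  next
    assume "Z ** Y = X ** Z"
    then have "inv\<^bsub>G\<^esub> Z ** (Z ** Y) = inv\<^bsub>G\<^esub> Z ** (X ** Z)" by simp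
    then show "Y = conjugate_by G X Z"
      by (simp add: conjugate_by_def mult inv matrix_mul_assoc)
  qed
qed

lemma conjugacy_class_eq: "conjugacy_class G X = {Y. \<exists>Z\<in>carrier G. Z ** Y = X ** Z}"
  using conjugate_by_iff by (auto simp: conjugacy_class_def conjugate_in_def)

lemma mat_pow_eq: "X [^]\<^bsub>G\<^esub> (k::nat) = mat_pow X k"
  by (induction k) (simp_all add: mult one mat_pow_commute)

text \<open>Provides the exponent for averaging over the powers of \<open>X\<close>, namely its
  order in the group.\<close>

lemma semisimple_order:
  assumes "X \<in> carrier G" "semisimple G X"
  obtains N where "mat_pow X N = mat 1" "of_nat N \<noteq> (0::'a)"
proof
  show "mat_pow X (ord X) = mat 1"
    using pow_ord_eq_1[OF assms(1)] by (simp add: mat_pow_eq one)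
  show "of_nat (ord X) \<noteq> (0::'a)"
  proof
    assume "of_nat (ord X) = (0::'a)"
    then have "CHAR('a) dvd ord X"
      by (simp add: of_nat_eq_0_iff_char_dvd)
    then have "CHAR('a) = 1"
      using assms(2) by (metis semisimple_def coprime_common_divisor_nat dvd_refl)
    then show False by simp
  qed
qed

lemma carrier_special: "carrier (special_subgroup G) = {A \<in> carrier G. det A = 1}"
  by (simp add: special_subgroup_def)

lemma special_matrix_group: "matrix_group (special_subgroup G)"
proof
  fix A assume A: "A \<in> carrier (special_subgroup G)"
  then obtain B where B: "B \<in> carrier G" "B ** A = mat 1"
    using matrix_inverse_closed by (auto simp: carrier_special)
  then have "det B * det A = 1"
    by (metis det_I det_mul)
  then show "\<exists>B\<in>carrier (special_subgroup G). B ** A = mat 1"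
    using A B by (auto simp: carrier_special)
qed (auto simp: special_subgroup_def mult one mat_1_closed matrix_mult_closed det_mul)

lemma conjugacy_class_special:
  "conjugacy_class (special_subgroup G) X = {Y. \<exists>Z\<in>carrier G. det Z = 1 \<and> Z ** Y = X ** Z}"
  unfolding matrix_group.conjugacy_class_eq[OF special_matrix_group] by (auto simp: carrier_special)

text \<open>Replacing the conjugating element \<open>Z\<close> by \<open>W ** Z\<close> corrects its
  determinant and leaves the conjugate of \<open>X\<close> unchanged.\<close>

lemma conjugacy_class_special_eq:
  assumes "\<And>Z. Z \<in> carrier G \<Longrightarrow> \<exists>W\<in>carrier G. commute X W \<and> det W * det Z = 1"
  shows "conjugacy_class (special_subgroup G) X = conjugacy_class G X"
proof -
  have "\<exists>Z\<in>carrier G. det Z = 1 \<and> Z ** Y = X ** Z" if Z: "Z \<in> carrier G" "Z ** Y = X ** Z" for Y Z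
  proof -
    obtain W where W: "W \<in> carrier G" "commute X W" "det W * det Z = 1"
      using assms Z(1) by blast
    have "(W ** Z) ** Y = W ** (X ** Z)"
      by (simp add: Z(2) flip: matrix_mul_assoc)
    also have "\<dots> = X ** (W ** Z)"
      using W(2) by (simp add: commute_def matrix_mul_assoc)
    finally show ?thesis
      using W Z(1) by (intro bexI[of _ "W ** Z"]) (auto simp: det_mul matrix_mult_closed)
  qed
  then show ?thesis
    unfolding conjugacy_class_special conjugacy_class_eq by blast
qed

text \<open>The special class of \<open>X'\<close> consists of the conjugates of \<open>X\<close> by
  elements of determinant \<open>- 1\<close>. A conjugate by both \<open>S\<close> and
  \<open>T\<close> of determinants \<open>1\<close> and \<open>- 1\<close> would make
  \<open>T\<close> times the inverse of \<open>S\<close> a centralizing element of determinant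
  \<open>- 1\<close>.\<close>

lemma conjugacy_class_special_split:
  assumes two: "(2::'a) \<noteq> 0"
    and dets: "\<And>Z. Z \<in> carrier G \<Longrightarrow> det Z = 1 \<or> det Z = - 1"
    and centralizer: "\<And>W. W \<in> carrier G \<Longrightarrow> commute X W \<Longrightarrow> det W = 1"
    and X: "X \<in> carrier (special_subgroup G)" and Z: "Z \<in> carrier G" "det Z = - 1"
  defines "X' \<equiv> conjugate_by G X Z"
  shows "X' \<in> carrier (special_subgroup G)"
    and "conjugacy_class G X = conjugacy_class (special_subgroup G) X \<union> conjugacy_class (special_subgroup G) X'"
    and "conjugacy_class (special_subgroup G) X \<noteq> conjugacy_class (special_subgroup G) X'"
    and "conjugacy_class (special_subgroup G) X \<inter> conjugacy_class (special_subgroup G) X' = {}"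
proof -
  have X': "Z ** X' = X ** Z"
    using conjugate_by_iff[OF Z(1)] X'_def by blast
  have XG: "X \<in> carrier G" "det X = 1"
    using X by (auto simp: carrier_special)
  have "X' \<in> carrier G"
    unfolding X'_def conjugate_by_def using XG Z by simp
  moreover have "det X' = 1"
    using arg_cong[OF X', of det] Z(2) XG(2) by (simp add: det_mul)
  ultimately show "X' \<in> carrier (special_subgroup G)"
    by (simp add: carrier_special)
  have class_X': "Y \<in> conjugacy_class (special_subgroup G) X' \<longleftrightarrow>
      (\<exists>T\<in>carrier G. det T = - 1 \<and> T ** Y = X ** T)" for Y
  proof
    assume "Y \<in> conjugacy_class (special_subgroup G) X'"
    then obtain S where S: "S \<in> carrier G" "det S = 1" "S ** Y = X' ** S"
      unfolding conjugacy_class_special by blast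
    have "(Z ** S) ** Y = (Z ** X') ** S"
      using S(3) by (simp flip: matrix_mul_assoc)
    also have "\<dots> = X ** (Z ** S)"
      by (simp add: X' matrix_mul_assoc)
    finally show "\<exists>T\<in>carrier G. det T = - 1 \<and> T ** Y = X ** T"
      using S Z by (intro bexI[of _ "Z ** S"]) (auto simp: det_mul matrix_mult_closed)
  next
    assume "\<exists>T\<in>carrier G. det T = - 1 \<and> T ** Y = X ** T"
    then obtain T where T: "T \<in> carrier G" "det T = - 1" "T ** Y = X ** T" by blast
    obtain Z' where Z': "Z' \<in> carrier G" "Z' ** Z = mat 1"
      using matrix_inverse_closed Z(1) by blast
    then have ZZ': "Z ** Z' = mat 1"
      using matrix_left_right_inverse by blast
    have "det Z' = - 1"
      using arg_cong[OF ZZ', of det] Z(2) by (simp add: det_mul minus_equation_iff)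
    have "(Z' ** T) ** Y = Z' ** X ** T"
      using T(3) by (simp flip: matrix_mul_assoc)
    also have "\<dots> = Z' ** (X ** Z) ** (Z' ** T)"
      using ZZ' by (metis matrix_mul_assoc matrix_mul_rid)
    also have "\<dots> = X' ** (Z' ** T)"
      unfolding X'[symmetric] using Z'(2) by (simp add: matrix_mul_assoc)
    finally show "Y \<in> conjugacy_class (special_subgroup G) X'"
      unfolding conjugacy_class_special using T Z' \<open>det Z' = - 1\<close>
      by (intro CollectI bexI[of _ "Z' ** T"]) (auto simp: det_mul matrix_mult_closed)
  qed
  show "conjugacy_class G X = conjugacy_class (special_subgroup G) X \<union> conjugacy_class (special_subgroup G) X'"
    using dets unfolding set_eq_iff Un_iff class_X' unfolding conjugacy_class_special conjugacy_class_eq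
    by blast
  show disjoint: "conjugacy_class (special_subgroup G) X \<inter> conjugacy_class (special_subgroup G) X' = {}"
  proof (rule ccontr)
    assume "\<not> ?thesis"
    then obtain Y where "Y \<in> conjugacy_class (special_subgroup G) X" "Y \<in> conjugacy_class (special_subgroup G) X'"
      by blast
    then obtain S T where S: "S \<in> carrier G" "det S = 1" "S ** Y = X ** S"
      and T: "T \<in> carrier G" "det T = - 1" "T ** Y = X ** T"
      unfolding class_X' unfolding conjugacy_class_special by blast
    obtain S' where S': "S' \<in> carrier G" "S' ** S = mat 1"
      using matrix_inverse_closed S(1) by blast
    then have SS': "S ** S' = mat 1"
      using matrix_left_right_inverse by blast
    have "det S' = 1"
      using arg_cong[OF SS', of det] S(2) by (simp add: det_mul)
    have "Y ** S' = S' ** (S ** Y) ** S'"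
      using S'(2) by (simp add: matrix_mul_assoc)
    also have "\<dots> = S' ** X ** (S ** S')"
      by (simp only: S(3) matrix_mul_assoc)
    finally have YS': "Y ** S' = S' ** X"
      by (simp add: SS')
    have "X ** (T ** S') = T ** (Y ** S')"
      by (simp add: T(3) matrix_mul_assoc)
    also have "\<dots> = (T ** S') ** X"
      by (simp only: YS' matrix_mul_assoc)
    finally have "det (T ** S') = 1"
      using centralizer[of "T ** S'"] T(1) S'(1) matrix_mult_closed by (simp add: commute_def)
    then have "(- 1 :: 'a) = 1"
      using T(2) \<open>det S' = 1\<close> by (simp add: det_mul)
    then show False
      using two by (metis add.right_inverse one_add_one)
  qed
  have "X \<in> conjugacy_class (special_subgroup G) X"
    unfolding conjugacy_class_special by (intro CollectI bexI[OF _ mat_1_closed]) simp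
  then show "conjugacy_class (special_subgroup G) X \<noteq> conjugacy_class (special_subgroup G) X'"
    using disjoint by blast
qed

end

lemma (in reflexive_form) isometry_matrix_group:
  assumes "mult G = (**)" "one G = mat 1" "\<And>A. A \<in> carrier G \<longleftrightarrow> isometry A"
  shows "matrix_group G"
proof
  fix A assume "A \<in> carrier G"
  then show "\<exists>B\<in>carrier G. B ** A = mat 1"
    using assms(3) isometry_iff isometry_inverse by blast
qed (use assms isometry_mult in \<open>auto simp: isometry_def\<close>)

theorem theorem4p1p12:
  fixes q :: nat
  assumes "primepow q"
  shows
    "(\<forall>\<beta> :: 'k::{field,finite} ^ 'n \<Rightarrow> 'k ^ 'n \<Rightarrow> 'k.
        CARD('k) = q\<^sup>2 \<and> hermitian_form q \<beta> \<and> nondegenerate_form \<beta> \<longrightarrow>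
        (let U = unitary_group \<beta>; SU = special_subgroup U in
          (\<forall>X \<in> carrier SU. semisimple SU X \<longrightarrow>
             conjugacy_class SU X = conjugacy_class U X) \<and>
          (\<forall>X \<in> carrier SU. \<forall>Y \<in> carrier SU. semisimple SU X \<and> semisimple SU Y \<longrightarrow>
             (conjugate_in SU X Y \<longleftrightarrow> conjugate_in U X Y)))) \<and>
     (\<forall>(Q :: 'f::{field,finite} ^ 'n \<Rightarrow> 'f) \<epsilon>.
        CARD('f) = q \<and> odd q \<and> nonsingular_quadratic_form Q \<and> has_sign Q \<epsilon> \<longrightarrow>
        (let OQ = orthogonal_group Q; SOQ = special_subgroup OQ in
          \<forall>X \<in> carrier SOQ. semisimple SOQ X \<longrightarrow>
            (if \<not> invertible (X ** X - mat 1)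
             then conjugacy_class SOQ X = conjugacy_class OQ X
             else (\<exists>Z \<in> carrier OQ. det Z = -1) \<and>
                  (\<forall>Z \<in> carrier OQ. det Z = -1 \<longrightarrow>
                     conjugate_by OQ X Z \<in> carrier SOQ \<and>
                     conjugacy_class OQ X =
                       conjugacy_class SOQ X \<union> conjugacy_class SOQ (conjugate_by OQ X Z) \<and>
                     conjugacy_class SOQ X \<noteq> conjugacy_class SOQ (conjugate_by OQ X Z) \<and>
                     conjugacy_class SOQ X \<inter> conjugacy_class SOQ (conjugate_by OQ X Z) = {}))))"
proof (intro conjI allI impI)
  fix \<beta> :: "'k ^ 'n \<Rightarrow> 'k ^ 'n \<Rightarrow> 'k"
  assume \<beta>: "CARD('k) = q\<^sup>2 \<and> hermitian_form q \<beta> \<and> nondegenerate_form \<beta>"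
  let ?U = "unitary_group \<beta>" and ?SU = "special_subgroup (unitary_group \<beta>)"
  have q: "primepow q" "CARD('k) = q\<^sup>2" using assms \<beta> by auto
  have form: "reflexive_form (\<lambda>x. x ^ q) 1 \<beta>"
    using hermitian_reflexive_form q \<beta> by blast
  interpret reflexive_form "\<lambda>x. x ^ q" 1 \<beta> by fact
  have carrier: "A \<in> carrier ?U \<longleftrightarrow> isometry A" for A
    using isometry_invertible by (auto simp: unitary_group_def isometry_def)
  interpret matrix_group ?U
    by (rule isometry_matrix_group)
      (simp_all add: carrier, simp_all add: unitary_group_def general_linear_group_def)
  have class_eq: "conjugacy_class ?SU X = conjugacy_class ?U X"
    if X: "X \<in> carrier ?SU" "semisimple ?SU X" for X
  proof (rule conjugacy_class_special_eq)
    obtain N where N: "mat_pow X N = mat 1" "of_nat N \<noteq> (0::'k)"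
      using matrix_group.semisimple_order[OF special_matrix_group X] .
    have iso: "isometry X"
      using X(1) by (simp add: carrier_special carrier)
    fix Z assume "Z \<in> carrier ?U"
    then have det_Z: "det Z * det Z ^ q = 1"
      using isometry_det by (simp add: carrier mult.commute)
    \<comment> \<open>The required determinant \<open>det Z ^ q\<close>, the inverse of
      \<open>det Z\<close>, again has norm one, so Hilbert 90 applies to it.\<close>
    then have "(det Z ^ q) * (det Z ^ q) ^ q = 1"
      by (metis power_mult_distrib power_one)
    then obtain \<mu> where \<mu>: "\<mu> \<noteq> 0" "det Z ^ q * \<mu> ^ q = \<mu>"
      using hilbert_90[OF q] by blast
    obtain W where W: "isometry W" "commute X W" "det W * \<mu> ^ q = \<mu>"
      using exists_commuting_isometry_det[OF form iso N \<mu>(1)] by blast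
    have "det W = det Z ^ q"
      using W(3) \<mu> by (metis mult_right_cancel power_eq_0_iff mult_zero_right)
    then show "\<exists>W\<in>carrier ?U. commute X W \<and> det W * det Z = 1"
      using W det_Z by (auto simp: carrier mult.commute)
  qed
  then show "let U = ?U; SU = special_subgroup U in
      (\<forall>X \<in> carrier SU. semisimple SU X \<longrightarrow> conjugacy_class SU X = conjugacy_class U X) \<and>
      (\<forall>X \<in> carrier SU. \<forall>Y \<in> carrier SU. semisimple SU X \<and> semisimple SU Y \<longrightarrow>
        (conjugate_in SU X Y \<longleftrightarrow> conjugate_in U X Y))"
    unfolding Let_def by (auto simp: conjugacy_class_def)
next
  fix Q :: "'f ^ 'n \<Rightarrow> 'f" and \<epsilon>
  assume Q: "CARD('f) = q \<and> odd q \<and> nonsingular_quadratic_form Q \<and> has_sign Q \<epsilon>"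
  let ?O = "orthogonal_group Q" and ?SO = "special_subgroup (orthogonal_group Q)"
  have two: "(2::'f) \<noteq> 0"
    using two_neq_0_field Q by blast
  have form: "reflexive_form (\<lambda>x. x) 1 (polar_form Q)"
    using polar_reflexive_form two Q by blast
  interpret reflexive_form "\<lambda>x. x" 1 "polar_form Q" by fact
  have carrier: "A \<in> carrier ?O \<longleftrightarrow> isometry A" for A
    using isometry_invertible polar_isometry_iff[OF _ two] Q by (auto simp: orthogonal_group_def)
  interpret matrix_group ?O
    by (rule isometry_matrix_group)
      (simp_all add: carrier, simp_all add: orthogonal_group_def general_linear_group_def)
  have dets: "det Z = 1 \<or> det Z = - 1" if "Z \<in> carrier ?O" for Z
    using isometry_det[of Z] that by (simp add: carrier square_eq_1_iff)
  show "let OQ = ?O; SOQ = special_subgroup OQ in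
      \<forall>X \<in> carrier SOQ. semisimple SOQ X \<longrightarrow>
        (if \<not> invertible (X ** X - mat 1)
         then conjugacy_class SOQ X = conjugacy_class OQ X
         else (\<exists>Z \<in> carrier OQ. det Z = -1) \<and>
              (\<forall>Z \<in> carrier OQ. det Z = -1 \<longrightarrow>
                 conjugate_by OQ X Z \<in> carrier SOQ \<and>
                 conjugacy_class OQ X =
                   conjugacy_class SOQ X \<union> conjugacy_class SOQ (conjugate_by OQ X Z) \<and>
                 conjugacy_class SOQ X \<noteq> conjugacy_class SOQ (conjugate_by OQ X Z) \<and>
                 conjugacy_class SOQ X \<inter> conjugacy_class SOQ (conjugate_by OQ X Z) = {}))"
    unfolding Let_def
  proof (intro ballI impI)
    fix X assume X: "X \<in> carrier ?SO" "semisimple ?SO X"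
    obtain N where N: "mat_pow X N = mat 1" "of_nat N \<noteq> (0::'f)"
      using matrix_group.semisimple_order[OF special_matrix_group X] .
    have iso: "isometry X"
      using X(1) by (simp add: carrier_special carrier)
    show "if \<not> invertible (X ** X - mat 1)
         then conjugacy_class ?SO X = conjugacy_class ?O X
         else (\<exists>Z \<in> carrier ?O. det Z = -1) \<and>
              (\<forall>Z \<in> carrier ?O. det Z = -1 \<longrightarrow>
                 conjugate_by ?O X Z \<in> carrier ?SO \<and>
                 conjugacy_class ?O X =
                   conjugacy_class ?SO X \<union> conjugacy_class ?SO (conjugate_by ?O X Z) \<and>
                 conjugacy_class ?SO X \<noteq> conjugacy_class ?SO (conjugate_by ?O X Z) \<and>
                 conjugacy_class ?SO X \<inter> conjugacy_class ?SO (conjugate_by ?O X Z) = {})"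
    proof (cases "invertible (X ** X - mat 1)")
      case False
      obtain s where s: "isometry s" "det s = - 1" "commute X s"
        using exists_commuting_reflection[OF refl refl two iso N False] by blast
      have "conjugacy_class ?SO X = conjugacy_class ?O X"
      proof (rule conjugacy_class_special_eq)
        fix Z assume "Z \<in> carrier ?O"
        then consider "det Z = 1" | "det Z = - 1" using dets by blast
        \<comment> \<open>The determinant of \<open>Z\<close> is its own inverse: the identity
          serves for \<open>1\<close>, the commuting reflection for \<open>- 1\<close>.\<close>
        then show "\<exists>W\<in>carrier ?O. commute X W \<and> det W * det Z = 1"
        proof cases
          case 1
          then show ?thesis
            by (intro bexI[OF _ mat_1_closed]) (simp add: commute_mat)
        next
          case 2
          then show ?thesis
            using s by (intro bexI[of _ s]) (simp_all add: carrier)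
        qed
      qed
      then show ?thesis using False by simp
    next
      case True
      have "\<exists>Z \<in> carrier ?O. det Z = -1"
        using exists_isometry_det_minus_1[OF refl refl two] carrier by blast
      moreover have "det W = 1" if "W \<in> carrier ?O" "commute X W" for W
        using commuting_isometry_det[OF form two iso True] that carrier by blast
      note conjugacy_class_special_split[OF two dets this X(1)]
      ultimately show ?thesis
        using True by simp
    qed
  qed
qed

end
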